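(* Consider essential groups $G$ (contained in $G^{max}$, with twist part $T_0$) together with discrete torsion $\varepsilon$, and the resulting Hodge pairs $(h^{1,1}_\varepsilon,h^{2,1}_\varepsilon)$. (i) For every essential $G$ there is a choice of $\varepsilon$ such that $(h^{1,1}_\varepsilon,h^{2,1}_\varepsilon)=(h^{2,1}_{1},h^{1,1}_{1})$, where the subscript $1$ denotes trivial discrete torsion. (ii) For the following groups the possible values of $(h^{1,1}_\varepsilon,h^{2,1}_\varepsilon)$, as $\varepsilon$ varies, are exactly those listed: - $\langle(0+,0-,0-),(0-,0+,0-),(0,1,1),(1,0,1)\rangle$: $(27,3),(15,15),(3,27)$; - $\langle(0+,0-,0-),(0-,0+,0-),(1,1,0),(\tau,\tau,0),(1,\tau,1)\rangle$: $(17,5),(11,11),(5,17)$; - $\langle(0+,0-,0-),(0-,0+,0-),(0,1,1),(1,0,1),(\tau,\tau,\tau)\rangle$: $(15,3),(9,9),(3,15)$; - $\langle(0+,0-,0-),(0-,0+,0-),(0,\tau,1),(\tau,1,0),(1,0,\tau),(1,1,1)\rangle$: $(15,3),(12,6),(9,9),(6,12),(3,15)$. (iii) The set of all pairs $(h^{1,1}_\varepsilon,h^{2,1}_\varepsilon)$ over all essential $G$ and all $\varepsilon$ is the symmetrization under $(a,b)\leftrightarrow(b,a)$ of the set of pairs arising with trivial discrete torsion.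
   Context: $X=E_1\times E_2\times E_3$ with $E_i=\mathbb{C}/(2\mathbb{Z}+2\tau_i\mathbb{Z})$; points of order dividing $2$ in $E_i$ are denoted $0,1,\tau,1+\tau$ (with $\tau=\tau_i$ in the $i$-th factor). $(\epsilon_1\delta_1,\epsilon_2\delta_2,\epsilon_3\delta_3)$ with $\delta_i\in\{+,-\}$ denotes $(z_i)\mapsto(\delta_iz_i+\epsilon_i)$; a triple without signs denotes a translation. $T_0\cong(\mathbb{Z}_2)^2$ is generated by $(0+,0-,0-)$ and $(0-,0+,0-)$; $G^{max}$ is generated by $T_0$ and all translations by points of order $2$. The twist part of a subgroup $G\subset G^{max}$ is its image in $T_0$ under taking signs; $G$ is essential if it contains no translation by a nonzero element of a single factor $E_i$. For essential $G$ with twist part $T_0$, the rank $r$ is the $\mathbb{Z}_2$-dimension of its subgroup of translations, so $G\cong(\mathbb{Z}_2)^{r+2}$. Discrete torsion is a class in $H^2(G,U(1))$, equivalently an alternating bicharacter $\varepsilon:G\times G\to\{\pm1\}$ ($\varepsilon(g,g)=1$, bimultiplicative). The Hodge pair is $(h^{1,1}_\varepsilon,h^{2,1}_\varepsilon)=(3,3)+\sum_g c_\varepsilon(g)$, summed over all $g\in G\setminus\{1\}$ having fixed points on $X$. The fixed locus of such $g$ consists of $16$ elliptic curves. If the subgroup of $G$ mapping a component of the fixed locus onto itself is just $\langle g\rangle$, then $c_\varepsilon(g)=(2^{3-r},2^{3-r})$. Otherwise there is $h\in G$, $h\notin\langle g\rangle$, mapping each component of the fixed locus of $g$ onto itself,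 and $c_\varepsilon(g)=(2^{4-r},0)$ if $\varepsilon(g,h)=1$, $c_\varepsilon(g)=(0,2^{4-r})$ if $\varepsilon(g,h)=-1$. For $\varepsilon=1$ these are the Hodge numbers of a crepant resolution of $X/G$. *)

theory Defs
  imports "HOL-Analysis.Analysis" "HOL-Algebra.Bij" "HOL-Algebra.Generated_Groups"
begin

type_synonym triple = "complex \<times> complex \<times> complex"
type_synonym point = "complex set \<times> complex set \<times> complex set"

definition lattice :: "complex \<Rightarrow> complex set" where
  "lattice \<tau> = {2 * of_int m + 2 * of_int n * \<tau> | m n :: int. True}"

definition lattice_rel :: "complex \<Rightarrow> (complex \<times> complex) set" where
  "lattice_rel \<tau> = {(z, w). z - w \<in> lattice \<tau>}"

text \<open>A point of the elliptic curve is a coset of the lattice; the topology is the quotient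
  topology.\<close>

definition ell :: "complex \<Rightarrow> complex set set" where
  "ell \<tau> = UNIV // lattice_rel \<tau>"

definition ell_topology :: "complex \<Rightarrow> complex set topology" where
  "ell_topology \<tau> = topology (\<lambda>U. U \<subseteq> ell \<tau> \<and> open (\<Union> U))"

text \<open>A triple (t1, t2, t3) of period parameters determines the product of three elliptic curves.\<close>

definition X_topology :: "triple \<Rightarrow> point topology" where
  "X_topology = (\<lambda>(t1, t2, t3).
     prod_topology (ell_topology t1) (prod_topology (ell_topology t2) (ell_topology t3)))"

definition X :: "triple \<Rightarrow> point set" where
  "X = (\<lambda>(t1, t2, t3). ell t1 \<times> ell t2 \<times> ell t3)"

text \<open>\<open>mv \<tau> (e1, e2, e3) (d1, d2, d3)\<close> is the self-map of X induced by
  z_i \<mapsto> d_i z_i + e_i, where each d_i is 1 or -1. It is made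
  extensional (undefined outside X) so that it is an element of \<open>BijGroup (X \<tau>)\<close>.\<close>

definition aff :: "complex \<Rightarrow> complex \<Rightarrow> complex set \<Rightarrow> complex set" where
  "aff e d A = (\<lambda>z. d * z + e) ` A"

definition mv :: "triple \<Rightarrow> triple \<Rightarrow> triple \<Rightarrow> point \<Rightarrow> point" where
  "mv \<tau> = (\<lambda>(e1, e2, e3) (d1, d2, d3).
     restrict (\<lambda>(A1, A2, A3). (aff e1 d1 A1, aff e2 d2 A2, aff e3 d3 A3)) (X \<tau>))"

definition signs :: "triple set" where
  "signs = {1, -1} \<times> {1, -1} \<times> {1, -1}"

abbreviation transl :: "triple \<Rightarrow> triple \<Rightarrow> point \<Rightarrow> point" where
  "transl \<tau> e \<equiv> mv \<tau> e (1, 1, 1)"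

definition two_torsion :: "complex \<Rightarrow> complex set" where
  "two_torsion t = {0, 1, t, 1 + t}"

definition T0 :: "triple \<Rightarrow> (point \<Rightarrow> point) set" where
  "T0 \<tau> = generate (BijGroup (X \<tau>)) {mv \<tau> (0, 0, 0) (1, -1, -1), mv \<tau> (0, 0, 0) (-1, 1, -1)}"

definition Gmax :: "triple \<Rightarrow> (point \<Rightarrow> point) set" where
  "Gmax = (\<lambda>(t1, t2, t3). generate (BijGroup (X (t1, t2, t3)))
     (T0 (t1, t2, t3) \<union>
      transl (t1, t2, t3) ` (two_torsion t1 \<times> two_torsion t2 \<times> two_torsion t3)))"

definition twist_part :: "triple \<Rightarrow> (point \<Rightarrow> point) set \<Rightarrow> (point \<Rightarrow> point) set" where
  "twist_part \<tau> G = {mv \<tau> (0, 0, 0) d | d e. d \<in> signs \<and> mv \<tau> e d \<in> G}"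

definition translation_subgroup :: "triple \<Rightarrow> (point \<Rightarrow> point) set \<Rightarrow> (point \<Rightarrow> point) set" where
  "translation_subgroup \<tau> G = G \<inter> range (transl \<tau>)"

definition no_factor_translation :: "triple \<Rightarrow> (point \<Rightarrow> point) set \<Rightarrow> bool" where
  "no_factor_translation = (\<lambda>(t1, t2, t3) G.
     (\<forall>a. a \<notin> lattice t1 \<longrightarrow> transl (t1, t2, t3) (a, 0, 0) \<notin> G) \<and>
     (\<forall>a. a \<notin> lattice t2 \<longrightarrow> transl (t1, t2, t3) (0, a, 0) \<notin> G) \<and>
     (\<forall>a. a \<notin> lattice t3 \<longrightarrow> transl (t1, t2, t3) (0, 0, a) \<notin> G))"

definition essential :: "triple \<Rightarrow> (point \<Rightarrow> point) set \<Rightarrow> bool" where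
  "essential \<tau> G \<longleftrightarrow>
     subgroup G (BijGroup (X \<tau>)) \<and> G \<subseteq> Gmax \<tau> \<and> twist_part \<tau> G = T0 \<tau> \<and>
     no_factor_translation \<tau> G"

text \<open>The translations form an elementary abelian 2-group, so its dimension over the field with
  two elements is the logarithm of its order.\<close>

definition rank :: "triple \<Rightarrow> (point \<Rightarrow> point) set \<Rightarrow> nat" where
  "rank \<tau> G = (THE r. card (translation_subgroup \<tau> G) = 2 ^ r)"

definition discrete_torsion ::
    "triple \<Rightarrow> (point \<Rightarrow> point) set \<Rightarrow> ((point \<Rightarrow> point) \<Rightarrow> (point \<Rightarrow> point) \<Rightarrow> int) \<Rightarrow> bool" where
  "discrete_torsion \<tau> G \<epsilon> \<longleftrightarrow>
     (\<forall>g\<in>G. \<forall>h\<in>G. \<epsilon> g h \<in> {1, -1}) \<and>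
     (\<forall>g\<in>G. \<epsilon> g g = 1) \<and>
     (\<forall>g\<in>G. \<forall>h\<in>G. \<forall>k\<in>G. \<epsilon> (g \<otimes>\<^bsub>BijGroup (X \<tau>)\<^esub> h) k = \<epsilon> g k * \<epsilon> h k) \<and>
     (\<forall>g\<in>G. \<forall>h\<in>G. \<forall>k\<in>G. \<epsilon> g (h \<otimes>\<^bsub>BijGroup (X \<tau>)\<^esub> k) = \<epsilon> g h * \<epsilon> g k)"

definition fixed_locus :: "triple \<Rightarrow> (point \<Rightarrow> point) \<Rightarrow> point set" where
  "fixed_locus \<tau> g = {x \<in> X \<tau>. g x = x}"

definition fixed_components :: "triple \<Rightarrow> (point \<Rightarrow> point) \<Rightarrow> point set set" where
  "fixed_components \<tau> g = connected_components_of (subtopology (X_topology \<tau>) (fixed_locus \<tau> g))"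

definition stabilizer :: "(point \<Rightarrow> point) set \<Rightarrow> point set \<Rightarrow> (point \<Rightarrow> point) set" where
  "stabilizer G C = {h \<in> G. h ` C = C}"

text \<open>In the last case any two choices of h agree modulo g when G is essential,
  so the value does not depend on the choice. The exponents are taken in the integers since the
  rank can be 4.\<close>

definition contribution ::
    "triple \<Rightarrow> (point \<Rightarrow> point) set \<Rightarrow> ((point \<Rightarrow> point) \<Rightarrow> (point \<Rightarrow> point) \<Rightarrow> int) \<Rightarrow>
     (point \<Rightarrow> point) \<Rightarrow> rat \<times> rat" where
  "contribution \<tau> G \<epsilon> g =
     (let r = int (rank \<tau> G); gg = generate (BijGroup (X \<tau>)) {g} in
      if \<forall>C\<in>fixed_components \<tau> g. stabilizer G C = gg then (2 powi (3 - r), 2 powi (3 - r))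
      else let h = (SOME h. h \<in> G \<and> h \<notin> gg \<and> (\<forall>C\<in>fixed_components \<tau> g. h ` C = C)) in
        if \<epsilon> g h = 1 then (2 powi (4 - r), 0) else (0, 2 powi (4 - r)))"

definition hodge_pair ::
    "triple \<Rightarrow> (point \<Rightarrow> point) set \<Rightarrow> ((point \<Rightarrow> point) \<Rightarrow> (point \<Rightarrow> point) \<Rightarrow> int) \<Rightarrow> rat \<times> rat" where
  "hodge_pair \<tau> G \<epsilon> =
     (3, 3) + (\<Sum>g | g \<in> G \<and> g \<noteq> \<one>\<^bsub>BijGroup (X \<tau>)\<^esub> \<and> fixed_locus \<tau> g \<noteq> {}. contribution \<tau> G \<epsilon> g)"

abbreviation trivial_torsion :: "(point \<Rightarrow> point) \<Rightarrow> (point \<Rightarrow> point) \<Rightarrow> int" where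
  "trivial_torsion \<equiv> (\<lambda>g h. 1)"

definition hodge_values :: "triple \<Rightarrow> (point \<Rightarrow> point) set \<Rightarrow> (rat \<times> rat) set" where
  "hodge_values \<tau> G = {hodge_pair \<tau> G \<epsilon> | \<epsilon>. discrete_torsion \<tau> G \<epsilon>}"

text \<open>The group generated by the two generators of \<open>T0\<close> and the translations by the points in S.\<close>

definition T0_with :: "triple \<Rightarrow> triple set \<Rightarrow> (point \<Rightarrow> point) set" where
  "T0_with \<tau> S = generate (BijGroup (X \<tau>))
     ({mv \<tau> (0, 0, 0) (1, -1, -1), mv \<tau> (0, 0, 0) (-1, 1, -1)} \<union> transl \<tau> ` S)"

lemma equiv_lattice_rel: "equiv UNIV (lattice_rel \<tau>)"
proof (rule equivI)
  show "refl (lattice_rel \<tau>)"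
    unfolding refl_on_def lattice_rel_def lattice_def by (auto intro!: exI[of _ 0])
  show "sym (lattice_rel \<tau>)"
  proof (rule symI)
    fix z w assume "(z, w) \<in> lattice_rel \<tau>"
    then obtain m n :: int where "z - w = 2 * of_int m + 2 * of_int n * \<tau>"
      by (auto simp: lattice_rel_def lattice_def)
    then have "w - z = 2 * of_int (-m) + 2 * of_int (-n) * \<tau>"
      by (simp add: algebra_simps)
    then show "(w, z) \<in> lattice_rel \<tau>" unfolding lattice_rel_def lattice_def by blast
  qed
  show "trans (lattice_rel \<tau>)"
  proof (rule transI)
    fix u v w assume "(u, v) \<in> lattice_rel \<tau>" "(v, w) \<in> lattice_rel \<tau>"
    then obtain m n m' n' :: int where
      "u - v = 2 * of_int m + 2 * of_int n * \<tau>" "v - w = 2 * of_int m' + 2 * of_int n' * \<tau>"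
      by (auto simp: lattice_rel_def lattice_def)
    then have "u - w = 2 * of_int (m + m') + 2 * of_int (n + n') * \<tau>"
      by (simp add: algebra_simps)
    then show "(u, w) \<in> lattice_rel \<tau>" unfolding lattice_rel_def lattice_def by blast
  qed
qed simp

lemma openin_ell_topology:
  "openin (ell_topology \<tau>) U \<longleftrightarrow> U \<subseteq> ell \<tau> \<and> open (\<Union> U)"
proof -
  have disj: "\<Union> (U \<inter> V) = \<Union> U \<inter> \<Union> V" if "U \<subseteq> ell \<tau>" "V \<subseteq> ell \<tau>" for U V
    using that quotient_disj[OF equiv_lattice_rel] unfolding ell_def by blast
  have "istopology (\<lambda>U. U \<subseteq> ell \<tau> \<and> open (\<Union> U))"
    unfolding istopology_def
  proof (intro conjI allI impI)
    fix K :: "complex set set set"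
    assume K: "\<forall>S\<in>K. S \<subseteq> ell \<tau> \<and> open (\<Union> S)"
    have "\<Union> (\<Union> K) = (\<Union>S\<in>K. \<Union> S)" by blast
    then show "open (\<Union> (\<Union> K))" using K by auto
    show "\<Union> K \<subseteq> ell \<tau>" using K by blast
  qed (use disj in auto)
  then show ?thesis unfolding ell_topology_def by (simp add: topology_inverse')
qed

lemma aff_class:
  assumes "d = 1 \<or> d = -1"
  shows "aff e d (lattice_rel \<tau> `` {z}) = lattice_rel \<tau> `` {d * z + e}"
proof -
  have neg: "- x \<in> lattice \<tau>" if x: "x \<in> lattice \<tau>" for x
  proof -
    from x obtain m n :: int where "x = 2 * of_int m + 2 * of_int n * \<tau>"
      by (auto simp: lattice_def)
    then have "- x = 2 * of_int (-m) + 2 * of_int (-n) * \<tau>" by simp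
    then show ?thesis unfolding lattice_def by blast
  qed
  have sgn: "d * x \<in> lattice \<tau>" if "x \<in> lattice \<tau>" for x
    using assms neg[OF that] that by auto
  have dd: "d * (d * x) = x" for x using assms by auto
  show ?thesis
  proof (intro equalityI subsetI)
    fix w assume "w \<in> aff e d (lattice_rel \<tau> `` {z})"
    then obtain u where u: "w = d * u + e" "z - u \<in> lattice \<tau>"
      by (auto simp: aff_def lattice_rel_def)
    then have "d * z + e - w = d * (z - u)" by (simp add: algebra_simps)
    then show "w \<in> lattice_rel \<tau> `` {d * z + e}"
      using sgn[OF u(2)] by (simp add: lattice_rel_def)
  next
    fix w assume "w \<in> lattice_rel \<tau> `` {d * z + e}"
    then have "d * (d * z + e - w) \<in> lattice \<tau>"
      by (intro sgn) (simp add: lattice_rel_def)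
    moreover have "d * (d * z + e - w) = z - d * (w - e)"
      using dd[of z] by (simp add: algebra_simps)
    ultimately have "d * (w - e) \<in> lattice_rel \<tau> `` {z}" by (simp add: lattice_rel_def)
    moreover have "w = d * (d * (w - e)) + e" by (simp add: dd)
    ultimately show "w \<in> aff e d (lattice_rel \<tau> `` {z})"
      unfolding aff_def by blast
  qed
qed

lemma aff_bij:
  assumes "d = 1 \<or> d = -1"
  shows "bij_betw (aff e d) (ell \<tau>) (ell \<tau>)"
proof (rule bij_betw_byWitness[where f' = "aff (- d * e) d"])
  have d: "d * d = 1" using assms by auto
  show "\<forall>A\<in>ell \<tau>. aff (- d * e) d (aff e d A) = A" "\<forall>A\<in>ell \<tau>. aff e d (aff (- d * e) d A) = A"
    using assms by (auto simp: aff_def image_image algebra_simps)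
  show "aff e d ` ell \<tau> \<subseteq> ell \<tau>" "aff (- d * e) d ` ell \<tau> \<subseteq> ell \<tau>"
    unfolding ell_def using aff_class[OF assms] by (auto simp: quotient_def)
qed

lemma mv_in_BijGroup:
  assumes "d \<in> signs"
  shows "mv \<tau> e d \<in> carrier (BijGroup (X \<tau>))"
proof -
  obtain t1 t2 t3 e1 e2 e3 d1 d2 d3 where
    [simp]: "\<tau> = (t1, t2, t3)" "e = (e1, e2, e3)" "d = (d1, d2, d3)"
    by (metis prod_cases3)
  have d: "d1 = 1 \<or> d1 = -1" "d2 = 1 \<or> d2 = -1" "d3 = 1 \<or> d3 = -1"
    using assms by (auto simp: signs_def)
  have "bij_betw (map_prod (aff e1 d1) (map_prod (aff e2 d2) (aff e3 d3)))
          (ell t1 \<times> ell t2 \<times> ell t3) (ell t1 \<times> ell t2 \<times> ell t3)"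
    by (intro bij_betw_map_prod aff_bij d)
  also have "?this \<longleftrightarrow> bij_betw (mv \<tau> e d) (X \<tau>) (X \<tau>)"
    unfolding X_def by (simp, intro bij_betw_cong) (auto simp: mv_def X_def)
  finally show ?thesis
    by (simp add: BijGroup_def Bij_def mv_def)
qed

end

theory Submission
  imports Defs "HOL-Library.Z2"
begin

text \<open>All maps in \<open>Gmax\<close> commute and have order two, so \<open>Gmax\<close> is an eight-dimensional vector space over
  the field with two elements, and everything becomes linear algebra there. Let \<open>F\<^sub>i\<close> be the set of
  elements of G fixing some point and acting on the tangent space by \<open>+\<close> in the i-th direction only.
  An element \<open>g\<close> of \<open>F\<^sub>0\<close> has a nontrivial stabilizing partner iff it lies in a triangle
  \<open>(g, h, g + h)\<close> with \<open>h\<close> in \<open>F\<^sub>1\<close> and \<open>g + h\<close> in \<open>F\<^sub>2\<close>, and essentiality makes this triangle unique; the same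
  holds for the other \<open>F\<^sub>i\<close>. Hence, with v the number of translations in G, s the sum of the sizes of the
  \<open>F\<^sub>i\<close>, and D the sum of \<open>\<epsilon> g h\<close> over all triangles, the Hodge pair is
  \<open>(3 + 8/v (s + 3 D), 3 + 8/v (s - 3 D))\<close>. The determinant of the sign parts is a discrete torsion
  that is -1 on every triangle, which exchanges the two entries. The number N of triangles is
  0, 1, 2 or 4, and for N at least 2 the possible (v, s) form a short list, so that the
  values D other than N and -N only give (15, 15), (11, 11), (9, 9), (12, 6) and (6, 12); up to the exchange these
  are realised with trivial torsion by four explicit groups.\<close>

section \<open>Coordinates on the group of self-maps\<close>

type_synonym two_tors = "bit \<times> bit"

lemma bit_double [simp]: "(a :: bit) + a = 0"
  by (cases a) auto

lemma UNIV_bit: "(UNIV :: bit set) = {0, 1}"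
  by (metis (full_types) UNIV_eq_I bit_not_one_iff insertCI)

instance bit :: finite
  by standard (simp add: UNIV_bit)

text \<open>\<open>Code x y z (p, q)\<close> stands for the map whose shift in the three factors is given by the two-torsion
  points x, y, z, the pair (a, b) being the point \<open>a + b \<tau>\<close>, and whose sign part is the product of
  the p-th power of \<open>(+, -, -)\<close> and the q-th power of \<open>(-, +, -)\<close>.\<close>

datatype code = Code two_tors two_tors two_tors (twist: "bit \<times> bit")

text \<open>Componentwise addition models composition: signs act trivially on two-torsion points, so
  shifts and signs combine as a direct product. Every element is its own negative, hence the
  definition of \<open>-\<close>.\<close>

instantiation code :: ab_group_add
begin

definition "0 = Code 0 0 0 0"
fun plus_code :: "code \<Rightarrow> code \<Rightarrow> code" where
  "Code x y z d + Code x' y' z' d' = Code (x + x') (y + y') (z + z') (d + d')"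
definition "- (c :: code) = c"
definition "(c :: code) - d = c + d"

instance
proof
  fix a b c :: code
  show "a + b + c = a + (b + c)" by (cases a; cases b; cases c) (simp add: add.assoc)
  show "a + b = b + a" by (cases a; cases b) (simp add: add.commute)
  show "0 + a = a" by (cases a) (simp add: zero_code_def)
  show "- a + a = 0" by (cases a) (auto simp: zero_code_def uminus_code_def zero_prod_def)
  show "a - b = a + - b" by (simp add: minus_code_def uminus_code_def)
qed

end

instance code :: finite
proof
  have "UNIV = (\<lambda>(x, y, z, d). Code x y z d) ` UNIV"
    by (metis (no_types, lifting) UNIV_eq_I code.exhaust case_prod_conv rangeI)
  then show "finite (UNIV :: code set)" by (metis finite finite_imageI)
qed

lemma code_double [simp]: "(c :: code) + c = 0"
  by (metis add.left_inverse uminus_code_def)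

lemma code_double_left [simp]: "(c :: code) + (c + d) = d"
  by (simp flip: add.assoc)

lemma code_double_middle [simp]: "(c :: code) + d + c = d" "c + (d + c) = d"
  by (simp_all add: add.assoc add.commute[of d])

lemma code_double_cross: "(c :: code) + d + (c + e) = d + e"
  by (subst add.assoc, subst add.left_commute[of d c e], rule code_double_left)

lemma code_add_eq_iff: "(a :: code) + b = c \<longleftrightarrow> a = b + c"
  by (metis add.commute code_double_left)

definition coord :: "nat \<Rightarrow> code \<Rightarrow> two_tors" where
  "coord i c = (case c of Code x y z _ \<Rightarrow> if i = 0 then x else if i = 1 then y else z)"

definition sign_bit :: "nat \<Rightarrow> code \<Rightarrow> bit" where
  "sign_bit i c = (case c of Code _ _ _ (p, q) \<Rightarrow> if i = 0 then q else if i = 1 then p else p + q)"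

lemma coord_add [simp]: "coord i (c + d) = coord i c + coord i d"
  by (cases c; cases d) (simp add: coord_def)

lemma sign_bit_add [simp]: "sign_bit i (c + d) = sign_bit i c + sign_bit i d"
  by (cases c; cases d) (auto simp: sign_bit_def ac_simps)

lemma twist_add [simp]: "twist (c + d) = twist c + twist d"
  by (cases c; cases d) simp

lemma coord_0 [simp]: "coord i 0 = 0" and sign_bit_0 [simp]: "sign_bit i 0 = 0" and twist_0 [simp]: "twist 0 = 0"
  by (auto simp: coord_def sign_bit_def zero_code_def zero_prod_def)

section \<open>Directions, elements with fixed points and their stabilizing partners\<close>

definition index_perm :: "nat \<Rightarrow> nat \<Rightarrow> nat \<Rightarrow> bool" where
  "index_perm i j k \<longleftrightarrow> (i, j, k) \<in> {(0,1,2), (0,2,1), (1,0,2), (1,2,0), (2,0,1), (2,1,0)}"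

lemma index_perm_rot: "index_perm i j k \<Longrightarrow> index_perm j k i"
  by (auto simp: index_perm_def)

lemma all_index_perm: "index_perm i j k \<Longrightarrow> (\<forall>l<3. P l) \<longleftrightarrow> P i \<and> P j \<and> P k"
  by (auto simp: index_perm_def numeral_3_eq_3 less_Suc_eq numeral_2_eq_2)

text \<open>Every twist has determinant one, so the three sign bits sum to zero. This makes the
  three directions interchangeable although only two bits are stored.\<close>

lemma sign_bit_third: "index_perm i j k \<Longrightarrow> sign_bit k c = sign_bit i c + sign_bit j c"
  by (cases c) (auto simp: index_perm_def sign_bit_def ac_simps simp flip: add.assoc)

lemma twist_zero_iff: "index_perm i j k \<Longrightarrow> twist c = 0 \<longleftrightarrow> sign_bit i c = 0 \<and> sign_bit j c = 0"
  by (cases c) (auto simp: index_perm_def sign_bit_def zero_prod_def)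

lemma code_eqI:
  "index_perm i j k \<Longrightarrow> twist c = twist d \<Longrightarrow> coord i c = coord i d \<Longrightarrow> coord j c = coord j d \<Longrightarrow> coord k c = coord k d \<Longrightarrow> c = d"
  by (cases c; cases d) (auto simp: index_perm_def coord_def)

text \<open>In a direction with sign -1 an affine map always has fixed points, while a translation
  has them only when it is trivial. A nonzero twist negates exactly two directions, so only
  direction \<open>i\<close> imposes a condition on the shift.\<close>

definition fixers :: "nat \<Rightarrow> code set \<Rightarrow> code set" where
  "fixers i S = {c \<in> S. twist c \<noteq> 0 \<and> sign_bit i c = 0 \<and> coord i c = 0}"

definition transls :: "code set \<Rightarrow> code set" where
  "transls S = {c \<in> S. twist c = 0}"

lemma fixers_iff:
  assumes "index_perm i j k"
  shows "c \<in> fixers i S \<longleftrightarrow> c \<in> S \<and> sign_bit i c = 0 \<and> sign_bit j c = 1 \<and> sign_bit k c = 1 \<and> coord i c = 0"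
  using twist_zero_iff[OF assms, of c] sign_bit_third[OF assms, of c] by (auto simp: fixers_def)

text \<open>For \<open>g\<close> with fixed points this expresses that \<open>h\<close> maps each
  fixed component of \<open>g\<close> onto itself. In a direction negated by \<open>g\<close> a
  component is a single point z with 2z equal to the shift of \<open>g\<close>; it is fixed by the
  trivial translation and by reflections with the same shift. In the other direction the component
  is the whole curve and imposes nothing.\<close>

definition stabilizes :: "code \<Rightarrow> code \<Rightarrow> bool" where
  "stabilizes g h \<longleftrightarrow> (\<forall>i<3. sign_bit i g = 1 \<longrightarrow> coord i h = (if sign_bit i h = 1 then coord i g else 0))"

locale essential_code =
  fixes S :: "code set"
  assumes zero: "0 \<in> S"
    and add: "\<And>a b. a \<in> S \<Longrightarrow> b \<in> S \<Longrightarrow> a + b \<in> S"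
    and no_factor: "\<And>c i j k. index_perm i j k \<Longrightarrow> c \<in> S \<Longrightarrow> twist c = 0 \<Longrightarrow> coord j c = 0 \<Longrightarrow> coord k c = 0 \<Longrightarrow> c = 0"
begin

text \<open>Sort \<open>h\<close> by its signs in the two directions that \<open>g\<close> negates.
  If both are plus, \<open>h\<close> is a translation along factor \<open>i\<close> and hence 0; if
  both are minus, the same applies to \<open>g + h\<close>. With mixed signs, stabilizing means that
  one shift of \<open>h\<close> and one of \<open>g + h\<close> vanish, which places them in the
  other two sets of fixers.\<close>

lemma partner_iff:
  assumes p: "index_perm i j k" and g: "g \<in> fixers i S"
  shows "h \<in> S \<and> stabilizes g h \<and> h \<notin> {0, g} \<longleftrightarrow>
    (h \<in> fixers j S \<and> g + h \<in> fixers k S) \<or> (g + h \<in> fixers j S \<and> h \<in> fixers k S)"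
proof -
  have pj: "index_perm j i k" and pk: "index_perm k i j" using p by (auto simp: index_perm_def)
  have gS: "g \<in> S" and gi: "sign_bit i g = 0" "sign_bit j g = 1" "sign_bit k g = 1" "coord i g = 0"
    using g fixers_iff[OF p] by auto
  have st: "stabilizes g h \<longleftrightarrow> coord j h = (if sign_bit j h = 1 then coord j g else 0) \<and> coord k h = (if sign_bit k h = 1 then coord k g else 0)"
    unfolding stabilizes_def all_index_perm[OF p] using gi by simp
  have ij: "sign_bit i h = sign_bit j h + sign_bit k h"
    using sign_bit_third[OF p, of h] by (cases "sign_bit i h"; cases "sign_bit j h") auto
  have two: "(x :: two_tors) + x = 0" "x + y = 0 \<longleftrightarrow> y = x" for x y
    by (cases x; cases y; auto simp: zero_prod_def; metis add_eq_0_iff)+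
  have h0: "h = 0" if "sign_bit j h = 0" "sign_bit k h = 0" "stabilizes g h" "h \<in> S"
    using no_factor[OF p, of h] that st ij twist_zero_iff[OF p, of h] by auto
  have hg: "h = g" if "sign_bit j h = 1" "sign_bit k h = 1" "stabilizes g h" "h \<in> S"
  proof -
    have "g + h = 0"
      using no_factor[OF p, of "g + h"] that st ij twist_zero_iff[OF p, of "g + h"] gi add[OF gS] two
      by auto
    then show ?thesis by (metis code_add_eq_iff add.right_neutral)
  qed
  have inS: "g + h \<in> S \<longleftrightarrow> h \<in> S" using add[OF gS] by (metis code_double_left)
  show ?thesis
    unfolding fixers_iff[OF pj] fixers_iff[OF pk] st inS
    using h0 hg gi ij st two inS by (cases "sign_bit j h"; cases "sign_bit k h") auto
qed

text \<open>Two candidates differ by a translation whose shifts in directions \<open>j\<close> and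
  \<open>k\<close> both vanish, so essentiality forces the difference to be zero.\<close>

lemma partner_unique:
  assumes p: "index_perm i j k" and "h \<in> fixers j S" "h' \<in> fixers j S" "g + h \<in> fixers k S" "g + h' \<in> fixers k S"
  shows "h = h'"
proof -
  have pj: "index_perm j i k" and pk: "index_perm k i j" using p by (auto simp: index_perm_def)
  have "coord k (g + h) + coord k (g + h') = 0" "h \<in> S" "h' \<in> S" "coord j h = 0" "coord j h' = 0"
    "sign_bit j h = 0" "sign_bit j h' = 0" "sign_bit k h = 1" "sign_bit k h' = 1"
    using assms fixers_iff[OF pj] fixers_iff[OF pk] by auto
  moreover have "coord k (g + h) + coord k (g + h') = coord k (h + h')"
    by (subst coord_add[symmetric]) (simp only: code_double_cross)
  ultimately have "h + h' = 0"
    using no_factor[OF p, of "h + h'"] add[of h h'] twist_zero_iff[OF index_perm_rot[OF p], of "h + h'"]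
    by auto
  then show ?thesis by (metis code_add_eq_iff add.right_neutral)
qed

end

section \<open>Triangles and sums of discrete torsion over them\<close>

definition triangles :: "code set \<Rightarrow> (code \<times> code) set" where
  "triangles S = {(g, h). g \<in> fixers 0 S \<and> h \<in> fixers 1 S \<and> g + h \<in> fixers 2 S}"

definition torsion_sum :: "code set \<Rightarrow> (code \<Rightarrow> code \<Rightarrow> int) \<Rightarrow> int" where
  "torsion_sum S \<epsilon> = (\<Sum>(g, h) \<in> triangles S. \<epsilon> g h)"

definition alternating :: "code set \<Rightarrow> (code \<Rightarrow> code \<Rightarrow> int) \<Rightarrow> bool" where
  "alternating S \<epsilon> \<longleftrightarrow>
     (\<forall>g\<in>S. \<forall>h\<in>S. \<epsilon> g h \<in> {1, -1}) \<and> (\<forall>g\<in>S. \<epsilon> g g = 1) \<and>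
     (\<forall>g\<in>S. \<forall>h\<in>S. \<forall>k\<in>S. \<epsilon> (g + h) k = \<epsilon> g k * \<epsilon> h k) \<and>
     (\<forall>g\<in>S. \<forall>h\<in>S. \<forall>k\<in>S. \<epsilon> g (h + k) = \<epsilon> g h * \<epsilon> g k)"

context essential_code
begin

text \<open>Expanding \<open>\<epsilon> (g + h) (g + h) = 1\<close> bimultiplicatively shows that
  the product of the two mixed values is 1, and both are signs.\<close>

lemma alternating_sym:
  assumes "alternating S \<epsilon>" "g \<in> S" "h \<in> S"
  shows "\<epsilon> g h = \<epsilon> h g"
proof -
  have "\<epsilon> (g + h) (g + h) = 1" "\<epsilon> g g = 1" "\<epsilon> h h = 1" "\<epsilon> g h \<in> {1, -1}" "\<epsilon> h g \<in> {1, -1}"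
    using assms add by (auto simp: alternating_def)
  moreover have "\<epsilon> (g + h) (g + h) = \<epsilon> g g * \<epsilon> g h * (\<epsilon> h g * \<epsilon> h h)"
    using assms add unfolding alternating_def by metis
  ultimately show ?thesis by auto
qed

text \<open>Both partners of \<open>g\<close> in a triangle therefore give the same value, which
  makes the choice of \<open>h\<close> in a contribution harmless.\<close>

lemma alternating_add_self:
  assumes "alternating S \<epsilon>" "g \<in> S" "h \<in> S"
  shows "\<epsilon> g (g + h) = \<epsilon> g h"
proof -
  have "\<epsilon> g (g + h) = \<epsilon> g g * \<epsilon> g h" "\<epsilon> g g = 1"
    using assms unfolding alternating_def by metis+
  then show ?thesis by simp
qed

lemma fixers_subset: "fixers i S \<subseteq> S"
  by (auto simp: fixers_def)

text \<open>This lemma and the next two count triangles from each of their three vertices. An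
  alternating torsion takes a single value on all pairs of distinct vertices of a triangle, so every
  count gives the same sum. The factor 3 in the Hodge formula comes from here.\<close>

lemma sum_partner_0:
  "(\<Sum>g\<in>fixers 0 S. \<Sum>h | h \<in> fixers 1 S \<and> g + h \<in> fixers 2 S. \<epsilon> g h) = torsion_sum S \<epsilon>"
  unfolding torsion_sum_def
  by (subst sum.Sigma) (auto intro!: sum.cong simp: triangles_def)

lemma sum_partner_1:
  assumes a: "alternating S \<epsilon>"
  shows "(\<Sum>g\<in>fixers 1 S. \<Sum>h | h \<in> fixers 0 S \<and> g + h \<in> fixers 2 S. \<epsilon> g h) = torsion_sum S \<epsilon>"
proof -
  have "(\<Sum>(g, h)\<in>(SIGMA g:fixers 1 S. {h. h \<in> fixers 0 S \<and> g + h \<in> fixers 2 S}). \<epsilon> g h) =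
      (\<Sum>(g, h)\<in>triangles S. \<epsilon> g h)"
    using alternating_sym[OF a] fixers_subset
    by (intro sum.reindex_bij_witness[of _ prod.swap prod.swap])
      (auto simp: triangles_def add.commute subset_iff)
  then show ?thesis unfolding torsion_sum_def by (subst sum.Sigma) simp_all
qed

lemma sum_partner_2:
  assumes a: "alternating S \<epsilon>"
  shows "(\<Sum>g\<in>fixers 2 S. \<Sum>h | h \<in> fixers 0 S \<and> g + h \<in> fixers 1 S. \<epsilon> g h) = torsion_sum S \<epsilon>"
proof -
  \<comment> \<open>The triangle \<open>(g, h)\<close> is now seen from its vertex
    \<open>g + h\<close>, with \<open>g\<close> as the partner in \<open>fixers 0 S\<close>; the
    third vertex is recovered as \<open>g + h + g = h\<close>.\<close>
  let ?f = "\<lambda>(g, h). (g + h, g)" and ?T = "SIGMA g:fixers 2 S. {h. h \<in> fixers 0 S \<and> g + h \<in> fixers 1 S}"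
  have "?f ` triangles S = ?T"
  proof (intro equalityI subsetI)
    fix t assume "t \<in> ?T"
    then obtain g h where t: "t = (g, h)" "g \<in> fixers 2 S" "h \<in> fixers 0 S" "g + h \<in> fixers 1 S"
      by blast
    then have "t = ?f (h, g + h)" "(h, g + h) \<in> triangles S" using t by (simp_all add: triangles_def)
    then show "t \<in> ?f ` triangles S" by blast
  next
    fix t assume "t \<in> ?f ` triangles S"
    then obtain g h where t: "t = (g + h, g)" "g \<in> fixers 0 S" "h \<in> fixers 1 S" "g + h \<in> fixers 2 S"
      unfolding triangles_def by auto
    then show "t \<in> ?T" by simp
  qed
  moreover have "inj_on ?f (triangles S)"
  proof (rule inj_onI)
    fix t u :: "code \<times> code" assume "?f t = ?f u"
    then have "fst t + snd t = fst u + snd u" "fst t = fst u" unfolding case_prod_beta by blast+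
    then show "t = u" by (intro prod_eqI) (metis code_double_left)+
  qed
  ultimately have "(\<Sum>t\<in>?T. case t of (g, h) \<Rightarrow> \<epsilon> g h) = (\<Sum>t\<in>triangles S. case ?f t of (g, h) \<Rightarrow> \<epsilon> g h)"
    by (metis (no_types, lifting) sum.reindex_cong)
  also have "\<dots> = torsion_sum S \<epsilon>"
    unfolding torsion_sum_def
  proof (rule sum.cong[OF refl])
    fix t assume "t \<in> triangles S"
    moreover obtain g h where t: "t = (g, h)" by (cases t)
    ultimately have "g \<in> S" "h \<in> S" by (simp_all add: triangles_def fixers_def)
    then show "(case ?f t of (g, h) \<Rightarrow> \<epsilon> g h) = (case t of (g, h) \<Rightarrow> \<epsilon> g h)"
      unfolding t using alternating_sym[OF a, of "g + h" g] alternating_add_self[OF a, of g h] add by simp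
  qed
  finally show ?thesis by (subst sum.Sigma) simp_all
qed

lemma torsion_sum_cases:
  assumes a: "alternating S \<epsilon>"
  shows "\<exists>n\<le>card (triangles S). torsion_sum S \<epsilon> = int (card (triangles S)) - 2 * int n"
proof -
  \<comment> \<open>Each triangle with torsion -1 lowers the sum by 2 from its maximum.\<close>
  let ?B = "{t \<in> triangles S. case t of (g, h) \<Rightarrow> \<epsilon> g h = -1}"
  have v: "(case t of (g, h) \<Rightarrow> \<epsilon> g h) = 1 - 2 * (if t \<in> ?B then 1 else 0)" if "t \<in> triangles S" for t
  proof -
    obtain g h where Pair: "t = (g, h)" by (cases t)
    then have "\<epsilon> g h = 1 \<or> \<epsilon> g h = -1"
      using that a unfolding triangles_def alternating_def fixers_def by blast
    then show ?thesis using that Pair by auto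
  qed
  have "torsion_sum S \<epsilon> = (\<Sum>t\<in>triangles S. 1 - 2 * (if t \<in> ?B then 1 else 0))"
    unfolding torsion_sum_def by (rule sum.cong[OF refl]) (rule v)
  also have "\<dots> = int (card (triangles S)) - 2 * int (card ?B)"
    by (simp add: sum_subtractf flip: sum_distrib_left sum.inter_filter)
  finally show ?thesis by (intro exI[of _ "card ?B"]) (auto intro: card_mono)
qed

end

section \<open>Counting triangles\<close>

lemma two_tors_double [simp]: "(x :: two_tors) + x = 0"
  by (cases x) (simp add: zero_prod_def)

lemma card_subgroup_two_tors:
  fixes A :: "two_tors set"
  assumes "0 \<in> A" and add: "\<And>a b. a \<in> A \<Longrightarrow> b \<in> A \<Longrightarrow> a + b \<in> A"
  shows "card A \<in> {1, 2, 4}"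
proof -
  have eq: "x = y" if "x + y = 0" for x y :: two_tors
    by (metis that two_tors_double add_right_cancel)
  consider "A = {0}" | a where "a \<noteq> 0" "A = {0, a}" | a b where "a \<in> A" "b \<in> A" "a \<noteq> 0" "b \<noteq> 0" "a \<noteq> b"
    using assms(1) by blast
  then show ?thesis
  proof cases
    case (3 a b)
    then have "card {0, a, b, a + b} = 4" using eq[of a b] by (auto simp: card_insert_if)
    moreover have "{0, a, b, a + b} \<subseteq> A" using 3 assms by blast
    ultimately have "4 \<le> card A" by (metis card_mono finite)
    moreover have "card A \<le> card (UNIV :: two_tors set)" by (rule card_mono) simp_all
    moreover have "card (UNIV :: two_tors set) = 4"
      by (simp add: UNIV_bit card_cartesian_product flip: UNIV_Times_UNIV)
    ultimately show ?thesis by simp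
  qed simp_all
qed

context essential_code
begin

definition coord_kernel :: "nat \<Rightarrow> code set" where
  "coord_kernel i = {c \<in> transls S. coord i c = 0}"

lemma transls_add: "a \<in> transls S \<Longrightarrow> b \<in> transls S \<Longrightarrow> a + b \<in> transls S"
  and transls_zero: "0 \<in> transls S"
  by (auto simp: transls_def add zero)

text \<open>Rank-nullity for one coordinate map on the translations: every nonempty fibre is a coset
  of the kernel.\<close>

lemma card_transls: "card (transls S) = card (coord i ` transls S) * card (coord_kernel i)"
proof -
  have fib: "card {c \<in> transls S. coord i c = x} = card (coord_kernel i)" if x: "x \<in> coord i ` transls S" for x
  proof -
    obtain c0 where c0: "c0 \<in> transls S" "x = coord i c0" using x by blast
    have "{c \<in> transls S. coord i c = x} = (+) c0 ` coord_kernel i"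
    proof (intro equalityI subsetI)
      fix c assume "c \<in> {c \<in> transls S. coord i c = x}"
      then have "c0 + c \<in> coord_kernel i" using c0 transls_add by (auto simp: coord_kernel_def)
      then show "c \<in> (+) c0 ` coord_kernel i" by (metis code_double_left imageI)
    qed (use c0 transls_add in \<open>auto simp: coord_kernel_def\<close>)
    then show ?thesis by (simp add: card_image)
  qed
  have "card (transls S) = (\<Sum>x\<in>coord i ` transls S. card {c \<in> transls S. coord i c = x})"
    using sum.image_gen[of "transls S" "\<lambda>_. 1 :: nat" "coord i"] by simp
  then show ?thesis using fib by simp
qed

text \<open>A translation killed by two coordinates lies in a single factor, so it is zero.\<close>

lemma inj_on_coord_kernel:
  assumes "index_perm i j k"
  shows "inj_on (coord j) (coord_kernel i)"
proof (rule inj_onI)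
  fix c d assume cd: "c \<in> coord_kernel i" "d \<in> coord_kernel i" "coord j c = coord j d"
  then have "c + d \<in> transls S" "coord i (c + d) = 0" "coord j (c + d) = 0"
    by (auto simp: coord_kernel_def transls_add)
  then have "c + d = 0"
    using no_factor[OF index_perm_rot[OF index_perm_rot[OF assms]], of "c + d"] by (simp add: transls_def)
  then show "c = d" by (metis code_add_eq_iff add.right_neutral)
qed

text \<open>Through coordinate \<open>j\<close> the kernel of coordinate \<open>i\<close> embeds
  into the two-torsion of one curve. The resulting inequalities between kernels and images in
  different directions drive the final count.\<close>

lemma card_coord_kernel:
  assumes "index_perm i j k"
  shows "card (coord_kernel i) \<in> {1, 2, 4}" "card (coord_kernel i) \<le> card (coord j ` transls S)"
proof -
  have eq: "card (coord_kernel i) = card (coord j ` coord_kernel i)"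
    by (rule card_image[symmetric]) (rule inj_on_coord_kernel[OF assms])
  show "card (coord_kernel i) \<in> {1, 2, 4}"
    unfolding eq
  proof (rule card_subgroup_two_tors)
    show "0 \<in> coord j ` coord_kernel i"
      by (rule image_eqI[of _ _ 0]) (simp_all add: coord_kernel_def transls_zero)
    show "a + b \<in> coord j ` coord_kernel i" if "a \<in> coord j ` coord_kernel i" "b \<in> coord j ` coord_kernel i" for a b
    proof -
      obtain c d where "a = coord j c" "b = coord j d" "c \<in> coord_kernel i" "d \<in> coord_kernel i" using \<open>a \<in> _\<close> \<open>b \<in> _\<close> by blast
      then have "a + b = coord j (c + d)" "c + d \<in> coord_kernel i" by (auto simp: coord_kernel_def transls_add)
      then show ?thesis by blast
    qed
  qed
  show "card (coord_kernel i) \<le> card (coord j ` transls S)"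
    unfolding eq by (rule card_mono) (auto simp: coord_kernel_def)
qed

lemma card_image_transls: "card (coord i ` transls S) \<in> {1, 2, 4}"
proof (rule card_subgroup_two_tors)
  show "0 \<in> coord i ` transls S" by (rule image_eqI[of _ _ 0]) (simp_all add: transls_zero)
  show "a + b \<in> coord i ` transls S" if "a \<in> coord i ` transls S" "b \<in> coord i ` transls S" for a b
  proof -
    obtain c d where "a = coord i c" "b = coord i d" "c \<in> transls S" "d \<in> transls S" using \<open>a \<in> _\<close> \<open>b \<in> _\<close> by blast
    then have "a + b = coord i (c + d)" "c + d \<in> transls S" by (auto simp: transls_add)
    then show ?thesis by blast
  qed
qed

lemma card_transls_power: "\<exists>r. card (transls S) = 2 ^ r"
proof -
  have "\<exists>r. n = (2 :: nat) ^ r" if "n \<in> {1, 2, 4}" for n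
    using that by (auto intro: exI[of _ 0] exI[of _ 1] exI[of _ 2])
  then obtain r s where "card (coord 0 ` transls S) = 2 ^ r" "card (coord_kernel 0) = 2 ^ s"
    using card_image_transls[of 0] card_coord_kernel(1)[of 0 1 2] unfolding index_perm_def by blast
  then show ?thesis using card_transls[of 0] by (metis power_add)
qed

text \<open>A nonempty set of fixers is a coset of the kernel: adding \<open>g\<close> turns a fixer
  into a translation with vanishing shift in direction \<open>i\<close>.\<close>

lemma card_fixers:
  assumes p: "index_perm i j k" and g: "g \<in> fixers i S"
  shows "card (fixers i S) = card (coord_kernel i)"
proof -
  have gi: "g \<in> S" "sign_bit i g = 0" "sign_bit j g = 1" "coord i g = 0"
    using g fixers_iff[OF p] by simp_all
  have "fixers i S = (+) g ` coord_kernel i"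
  proof (intro equalityI subsetI)
    fix c assume "c \<in> fixers i S"
    then have c: "c \<in> S" "sign_bit i c = 0" "sign_bit j c = 1" "coord i c = 0"
      using fixers_iff[OF p] by simp_all
    then have "twist (g + c) = 0" using twist_zero_iff[OF p, of "g + c"] gi by simp
    then have "g + c \<in> coord_kernel i"
      using c gi add by (simp add: coord_kernel_def transls_def)
    then show "c \<in> (+) g ` coord_kernel i" by (metis code_double_left imageI)
  next
    fix c assume "c \<in> (+) g ` coord_kernel i"
    then obtain a where a: "c = g + a" "a \<in> S" "twist a = 0" "coord i a = 0"
      by (auto simp: coord_kernel_def transls_def)
    moreover have "sign_bit i a = 0" "sign_bit j a = 0" using twist_zero_iff[OF p, of a] a by simp_all
    ultimately show "c \<in> fixers i S"
      using gi add[of g a] sign_bit_third[OF p, of "g + a"] unfolding fixers_iff[OF p] by simp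
  qed
  then show ?thesis by (simp add: card_image)
qed

text \<open>By uniqueness of partners a triangle is determined by any one of its vertices. Hence the
  triangles inject into each set of fixers.\<close>

lemma inj_triangles:
  "inj_on fst (triangles S)" "inj_on snd (triangles S)" "inj_on (\<lambda>(g, h). g + h) (triangles S)"
proof -
  have p: "index_perm 0 1 2" "index_perm 1 0 2" "index_perm 2 0 1" by (simp_all add: index_perm_def)
  show "inj_on fst (triangles S)"
    using partner_unique[OF p(1)] by (auto simp: triangles_def inj_on_def)
  show "inj_on snd (triangles S)"
    using partner_unique[OF p(2)] by (auto simp: triangles_def inj_on_def add.commute)
  show "inj_on (\<lambda>(g, h). g + h) (triangles S)"
  proof (clarsimp simp: triangles_def inj_on_def)
    fix g h g' h' assume *: "g \<in> fixers 0 S" "h \<in> fixers (Suc 0) S" "g' \<in> fixers 0 S" "h' \<in> fixers (Suc 0) S"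
      "g + h = g' + h'"
    \<comment> \<open>Uniqueness of partners is applied at the common vertex \<open>g + h\<close>,
      whose partners in \<open>fixers 0 S\<close> are \<open>g\<close> and
      \<open>g'\<close>.\<close>
    have "g + h + g \<in> fixers 1 S" using *(2) by simp
    moreover have "g + h + g' \<in> fixers 1 S" unfolding *(5) using *(4) by simp
    ultimately have "g = g'" by (rule partner_unique[OF p(3) *(1,3)])
    then show "g = g' \<and> h = h'" using *(5) by simp
  qed
qed

lemma card_triangles_le:
  assumes "i < 3"
  shows "card (triangles S) \<le> card (fixers i S)"
proof -
  have "fst ` triangles S \<subseteq> fixers 0 S" "snd ` triangles S \<subseteq> fixers 1 S" "(\<lambda>(g, h). g + h) ` triangles S \<subseteq> fixers 2 S"
    by (auto simp: triangles_def)
  then show ?thesis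
    using assms inj_triangles[THEN card_inj_on_le] by (auto simp: numeral_3_eq_3 less_Suc_eq numeral_2_eq_2)
qed

text \<open>The triangles form an affine space, since the sum of three triangles is again a
  triangle. Relative to a base triangle, the shift of the second vertex in direction 0 embeds this
  space as a subgroup of the two-torsion of one curve.\<close>

lemma card_triangles:
  assumes "triangles S \<noteq> {}"
  shows "card (triangles S) \<in> {1, 2, 4}"
proof -
  obtain g0 h0 where t0: "(g0, h0) \<in> triangles S" using assms by auto
  let ?m = "\<lambda>(g, h). coord 0 (h0 + h)"
  have p: "index_perm 0 1 2" "index_perm 1 0 2" "index_perm 2 0 1" by (simp_all add: index_perm_def)
  have closed: "(g0 + (g + g'), h0 + (h + h')) \<in> triangles S" if "(g, h) \<in> triangles S" "(g', h') \<in> triangles S" for g h g' h'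
    using t0 that unfolding triangles_def fixers_iff[OF p(1)] fixers_iff[OF p(2)] fixers_iff[OF p(3)]
    by (auto simp: add) (simp_all add: ac_simps)
  \<comment> \<open>If two triangles have the same image, their second vertices differ by a
    translation that vanishes in directions 0 and 1, hence by zero.\<close>
  have "inj_on ?m (triangles S)"
  proof (clarsimp simp: inj_on_def simp del: coord_add)
    fix g h g' h' assume t: "(g, h) \<in> triangles S" "(g', h') \<in> triangles S" and eq: "coord 0 (h0 + h) = coord 0 (h0 + h')"
    then have "coord 0 h = coord 0 h'" by simp
    have "coord 0 (h + h') = 0" "h + h' \<in> S" "twist (h + h') = 0" "coord 1 (h + h') = 0"
      using t \<open>coord 0 h = _\<close> unfolding triangles_def fixers_iff[OF p(2)] by (auto simp: add twist_zero_iff[OF p(2)] simp del: twist_add)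
    then have "h + h' = 0" using no_factor[OF p(3)] by blast
    then have "h = h'" by (metis code_add_eq_iff add.right_neutral)
    then show "g = g' \<and> h = h'" using inj_onD[OF inj_triangles(2) _ t] by simp
  qed
  then have "card (triangles S) = card (?m ` triangles S)" by (simp add: card_image)
  moreover have "card (?m ` triangles S) \<in> {1, 2, 4}"
  proof (rule card_subgroup_two_tors)
    show "0 \<in> ?m ` triangles S" by (rule image_eqI[OF _ t0]) simp
    show "a + b \<in> ?m ` triangles S" if ab: "a \<in> ?m ` triangles S" "b \<in> ?m ` triangles S" for a b
    proof -
      obtain g h g' h' where t: "(g, h) \<in> triangles S" "(g', h') \<in> triangles S" "a = coord 0 (h0 + h)" "b = coord 0 (h0 + h')"
        using ab by auto
      have "a + b = coord 0 (h0 + h + (h0 + h'))" unfolding t by simp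
      also have "h0 + h + (h0 + h') = h0 + (h0 + (h + h'))" by (simp only: ac_simps)
      finally show ?thesis by (intro image_eqI[OF _ closed[OF t(1,2)]]) (simp only: prod.case)
    qed
  qed
  ultimately show ?thesis by simp
qed

text \<open>Let a and p be the kernel and image sizes of the coordinate maps. Then v = p a in each
  direction, each a is at most the p of any other direction, and N is at most every a. For N at
  least 2 all of them are 2 or 4. When v = 8, an a equal to 4 forces p = 4 and so a = 2 in the other
  two directions, which leaves s = 6 or s = 8.\<close>

lemma counts:
  fixes s defines "s \<equiv> card (fixers 0 S) + card (fixers 1 S) + card (fixers 2 S)"
  shows "card (triangles S) \<le> 1 \<or>
    card (triangles S) = 2 \<and> (card (transls S), s) \<in> {(4, 6), (8, 6), (8, 8), (16, 12)} \<or>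
    card (triangles S) = 4 \<and> (card (transls S), s) = (16, 12)"
proof (cases "triangles S = {}")
  case False
  then obtain g h where gh: "g \<in> fixers 0 S" "h \<in> fixers 1 S" "g + h \<in> fixers 2 S"
    by (auto simp: triangles_def)
  have p: "index_perm 0 1 2" "index_perm 1 0 2" "index_perm 2 0 1" by (simp_all add: index_perm_def)
  have s: "s = card (coord_kernel 0) + card (coord_kernel 1) + card (coord_kernel 2)"
    unfolding s_def using card_fixers[OF p(1) gh(1)] card_fixers[OF p(2) gh(2)] card_fixers[OF p(3) gh(3)] by simp
  have N: "card (triangles S) \<le> card (coord_kernel 0)" "card (triangles S) \<le> card (coord_kernel 1)" "card (triangles S) \<le> card (coord_kernel 2)"
    using card_triangles_le[of 0] card_triangles_le[of 1] card_triangles_le[of 2]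
      card_fixers[OF p(1) gh(1)] card_fixers[OF p(2) gh(2)] card_fixers[OF p(3) gh(3)] by simp_all
  have perms: "index_perm 0 1 2" "index_perm 0 2 1" "index_perm 1 0 2" "index_perm 1 2 0" "index_perm 2 0 1" "index_perm 2 1 0"
    by (simp_all add: index_perm_def)
  note le = perms[THEN card_coord_kernel(2)]
  have arith: "N \<le> 1 \<or> N = 2 \<and> (v, a0 + a1 + a2) \<in> {(4, 6), (8, 6), (8, 8), (16, 12)} \<or> N = 4 \<and> (v, a0 + a1 + a2) = (16, 12)"
    if as: "N \<in> {1, 2, 4}" "a0 \<in> {1, 2, 4}" "a1 \<in> {1, 2, 4}" "a2 \<in> {1, 2, 4}" "p0 \<in> {1, 2, 4}" "p1 \<in> {1, 2, 4}" "p2 \<in> {1, 2, 4}"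
     "N \<le> a0" "N \<le> a1" "N \<le> a2" "a0 \<le> p1" "a0 \<le> p2" "a1 \<le> p0" "a1 \<le> p2" "a2 \<le> p0" "a2 \<le> p1"
     "v = p0 * a0" "v = p1 * a1" "v = p2 * a2" for N v a0 a1 a2 p0 p1 p2 :: nat
  proof (cases "N = 1")
    case False
    have two: "x \<in> {2, 4}" if "x \<in> {1, 2, 4}" "N \<le> y" "y \<le> x" for x y
      using that False \<open>N \<in> _\<close> by auto
    have a: "a0 \<in> {2, 4}" "a1 \<in> {2, 4}" "a2 \<in> {2, 4}"
      using two[of a0 a0] two[of a1 a1] two[of a2 a2] as(2-4,8-10) by blast+
    have p: "p0 \<in> {2, 4}" "p1 \<in> {2, 4}" "p2 \<in> {2, 4}"
      using two[of p0 a1] two[of p1 a0] two[of p2 a0] as(5-16) by blast+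
    consider "N = 2" | "N = 4" using as(1) False by blast
    then show ?thesis
      using a p as(8-19) by cases (elim insertE emptyE; simp)+
  qed simp
  show ?thesis
    unfolding s
    by (rule arith[of _ _ _ _ "card (coord 0 ` transls S)" "card (coord 1 ` transls S)" "card (coord 2 ` transls S)"])
      (use card_triangles[OF False] card_coord_kernel(1)[OF p(1)] card_coord_kernel(1)[OF p(2)] card_coord_kernel(1)[OF p(3)]
        card_image_transls N le card_transls in auto)
qed simp

end

section \<open>Explicit groups\<close>

text \<open>Lists keep the explicit groups computable. The list doubles with each generator, so
  distinctness of its entries expresses linear independence of the generators and turns lengths into
  cardinalities.\<close>

fun xor_span :: "code list \<Rightarrow> code list" where
  "xor_span [] = [0]"
| "xor_span (a # as) = xor_span as @ map ((+) a) (xor_span as)"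

lemma zero_in_xor_span: "0 \<in> set (xor_span as)"
  by (induction as) auto

lemma xor_span_add: "c \<in> set (xor_span as) \<Longrightarrow> d \<in> set (xor_span as) \<Longrightarrow> c + d \<in> set (xor_span as)"
proof (induction as arbitrary: c d)
  case (Cons a as)
  have "\<exists>c'\<in>set (xor_span as). c = c' \<or> c = a + c'" "\<exists>d'\<in>set (xor_span as). d = d' \<or> d = a + d'"
    using Cons.prems by auto
  then obtain c' d' where cd: "c' \<in> set (xor_span as)" "d' \<in> set (xor_span as)" "c = c' \<or> c = a + c'" "d = d' \<or> d = a + d'"
    by blast
  have "c' + d' \<in> set (xor_span as)" using Cons.IH cd by blast
  moreover have "c + d = c' + d' \<or> c + d = a + (c' + d')"
    using cd(3,4) by (auto simp: code_double_cross ac_simps)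
  ultimately show ?case by auto
qed simp

lemma gens_in_xor_span: "set as \<subseteq> set (xor_span as)"
proof (induction as)
  case (Cons a as)
  have "a + 0 \<in> (+) a ` set (xor_span as)" using zero_in_xor_span by blast
  then show ?case using Cons by auto
qed simp

definition no_factor_list :: "code list \<Rightarrow> bool" where
  "no_factor_list xs \<longleftrightarrow> (\<forall>c\<in>set xs. twist c = 0 \<longrightarrow>
     (coord 0 c = 0 \<and> coord 1 c = 0) \<or> (coord 0 c = 0 \<and> coord 2 c = 0) \<or> (coord 1 c = 0 \<and> coord 2 c = 0) \<longrightarrow> c = 0)"

lemma essential_code_xor_span:
  assumes "no_factor_list (xor_span as)"
  shows "essential_code (set (xor_span as))"
proof
  show "c = 0" if "index_perm i j k" "c \<in> set (xor_span as)" "twist c = 0" "coord j c = 0" "coord k c = 0" for c i j k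
    using assms that unfolding no_factor_list_def index_perm_def by auto
qed (fact zero_in_xor_span xor_span_add)+

definition fixers_list :: "nat \<Rightarrow> code list \<Rightarrow> code list" where
  "fixers_list i xs = filter (\<lambda>c. twist c \<noteq> 0 \<and> sign_bit i c = 0 \<and> coord i c = 0) xs"

text \<open>The test on \<open>g + h\<close> omits membership because the list will be a span, which
  is closed under addition.\<close>

definition triangles_list :: "code list \<Rightarrow> (code \<times> code) list" where
  "triangles_list xs =
     filter (\<lambda>(g, h). twist (g + h) \<noteq> 0 \<and> sign_bit 2 (g + h) = 0 \<and> coord 2 (g + h) = 0)
       (List.product (fixers_list 0 xs) (fixers_list 1 xs))"

lemma list_stats:
  assumes "distinct xs"
  shows "card (transls (set xs)) = length (filter (\<lambda>c. twist c = 0) xs)"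
    and "card (fixers i (set xs)) = length (fixers_list i xs)"
  using assms distinct_card[of "filter _ xs"]
  by (simp_all add: transls_def fixers_def fixers_list_def flip: distinct_card)

lemma list_triangles:
  assumes "distinct (xor_span as)"
  shows "card (triangles (set (xor_span as))) = length (triangles_list (xor_span as))"
    and "torsion_sum (set (xor_span as)) \<epsilon> = (\<Sum>(g, h)\<leftarrow>triangles_list (xor_span as). \<epsilon> g h)"
proof -
  have *: "triangles (set (xor_span as)) = set (triangles_list (xor_span as))"
    using xor_span_add unfolding triangles_def triangles_list_def fixers_def fixers_list_def by auto
  moreover have d: "distinct (triangles_list (xor_span as))"
    using assms by (simp add: triangles_list_def fixers_list_def distinct_product)
  ultimately show "card (triangles (set (xor_span as))) = length (triangles_list (xor_span as))"
    by (simp add: distinct_card)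
  show "torsion_sum (set (xor_span as)) \<epsilon> = (\<Sum>(g, h)\<leftarrow>triangles_list (xor_span as). \<epsilon> g h)"
    unfolding torsion_sum_def * by (simp add: sum_list_distinct_conv_sum_set d)
qed

section \<open>Alternating bicharacters and their torsion sums\<close>

text \<open>The wedge product of two linear forms over the field with two elements, written
  multiplicatively as a sign.\<close>

definition wedge :: "(code \<Rightarrow> bit) \<Rightarrow> (code \<Rightarrow> bit) \<Rightarrow> code \<Rightarrow> code \<Rightarrow> int" where
  "wedge \<alpha> \<beta> g h = (if \<alpha> g * \<beta> h + \<alpha> h * \<beta> g = 0 then 1 else -1)"

lemma alternating_wedge:
  assumes "\<And>c d. \<alpha> (c + d) = \<alpha> c + \<alpha> d" "\<And>c d. \<beta> (c + d) = \<beta> c + \<beta> d"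
  shows "alternating S (wedge \<alpha> \<beta>)"
proof -
  \<comment> \<open>The sign of a bit is a character, so biadditivity of the exponent becomes
    bimultiplicativity.\<close>
  have sgn: "(if a + b = 0 then 1 else -1) = (if a = 0 then 1 else -1) * (if b = 0 then 1 else -1 :: int)" for a b :: bit
    by (cases a; cases b) simp_all
  have "(\<alpha> g + \<alpha> h) * \<beta> k + \<alpha> k * (\<beta> g + \<beta> h) = (\<alpha> g * \<beta> k + \<alpha> k * \<beta> g) + (\<alpha> h * \<beta> k + \<alpha> k * \<beta> h)" for g h k
    by (simp only: algebra_simps)
  moreover have "\<alpha> g * (\<beta> h + \<beta> k) + (\<alpha> h + \<alpha> k) * \<beta> g = (\<alpha> g * \<beta> h + \<alpha> h * \<beta> g) + (\<alpha> g * \<beta> k + \<alpha> k * \<beta> g)" for g h k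
    by (simp only: algebra_simps)
  ultimately show ?thesis
    unfolding alternating_def wedge_def assms sgn[symmetric] by (simp only: bit_double) simp
qed

lemma alternating_mult:
  assumes "alternating S \<epsilon>" "alternating S \<epsilon>'"
  shows "alternating S (\<lambda>g h. \<epsilon> g h * \<epsilon>' g h)"
proof -
  have "\<epsilon> g h * \<epsilon>' g h \<in> {1, -1}" if "g \<in> S" "h \<in> S" for g h
  proof -
    have "\<epsilon> g h = 1 \<or> \<epsilon> g h = -1" "\<epsilon>' g h = 1 \<or> \<epsilon>' g h = -1"
      using assms that unfolding alternating_def by blast+
    then show ?thesis by auto
  qed
  then show ?thesis using assms unfolding alternating_def by simp
qed

lemma alternating_one: "alternating S (\<lambda>g h. 1)"
  by (simp add: alternating_def)

abbreviation det_torsion :: "code \<Rightarrow> code \<Rightarrow> int" where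
  "det_torsion \<equiv> wedge (sign_bit 0) (sign_bit 1)"

lemma torsion_sum_one: "torsion_sum S (\<lambda>_ _. 1) = int (card (triangles S))"
  by (simp add: torsion_sum_def)

text \<open>In directions 0 and 1 the vertices \<open>g\<close> and \<open>h\<close> of a triangle
  have sign bits (0, 1) and (1, 0). Their determinant over the field with two elements is 1, so
  every summand changes sign.\<close>

lemma torsion_sum_det: "torsion_sum S (\<lambda>g h. \<epsilon> g h * det_torsion g h) = - torsion_sum S \<epsilon>"
  unfolding torsion_sum_def sum_negf[symmetric]
proof (rule sum.cong[OF refl])
  fix t assume t: "t \<in> triangles S"
  obtain g h where gh: "t = (g, h)" by (cases t)
  have "index_perm 0 1 2" "index_perm 1 0 2" by (simp_all add: index_perm_def)
  note this[THEN fixers_iff]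
  then have "sign_bit 0 g = 0" "sign_bit 1 g = 1" "sign_bit 0 h = 1" "sign_bit 1 h = 0"
    using t unfolding gh triangles_def by auto
  then have "det_torsion g h = -1" by (simp add: wedge_def)
  then show "(case t of (g, h) \<Rightarrow> \<epsilon> g h * det_torsion g h) = - (case t of (g, h) \<Rightarrow> \<epsilon> g h)"
    by (simp add: gh)
qed

lemma alternating_det: "alternating S det_torsion"
  by (rule alternating_wedge) simp_all

definition torsion_sums :: "code set \<Rightarrow> int set" where
  "torsion_sums S = {torsion_sum S \<epsilon> | \<epsilon>. alternating S \<epsilon>}"

lemma torsion_sums_uminus: "d \<in> torsion_sums S \<Longrightarrow> - d \<in> torsion_sums S"
  unfolding torsion_sums_def using alternating_mult[OF _ alternating_det] torsion_sum_det[symmetric] by blast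

lemma card_triangles_in_torsion_sums: "int (card (triangles S)) \<in> torsion_sums S"
  unfolding torsion_sums_def using alternating_one torsion_sum_one[symmetric] by blast

lemma (in essential_code) torsion_sums_subset:
  "d \<in> torsion_sums S \<Longrightarrow> \<exists>n\<le>card (triangles S). d = int (card (triangles S)) - 2 * int n"
  unfolding torsion_sums_def using torsion_sum_cases by blast

text \<open>A sum of two signs is 2, 0 or -2. The extremes come from trivial torsion and from the
  determinant, so only 0 needs a witness.\<close>

lemma torsion_sums_two:
  assumes "essential_code S" "card (triangles S) = 2" "0 \<in> torsion_sums S"
  shows "torsion_sums S = {2, 0, -2}"
proof -
  have "d \<in> {2, 0, -2}" if "d \<in> torsion_sums S" for d
    using essential_code.torsion_sums_subset[OF assms(1) that] assms(2) by (auto simp: le_Suc_eq numeral_2_eq_2)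
  moreover have "2 \<in> torsion_sums S" using card_triangles_in_torsion_sums[of S] assms by simp
  moreover have "-2 \<in> torsion_sums S" using torsion_sums_uminus[OF calculation(2)] .
  ultimately show ?thesis using assms by blast
qed

lemma torsion_sums_four:
  assumes "essential_code S" "card (triangles S) = 4" "0 \<in> torsion_sums S" "2 \<in> torsion_sums S"
  shows "torsion_sums S = {4, 2, 0, -2, -4}"
proof -
  have "d \<in> {4, 2, 0, -2, -4}" if d: "d \<in> torsion_sums S" for d
  proof -
    obtain n where "n \<le> 4" "d = 4 - 2 * int n"
      using essential_code.torsion_sums_subset[OF assms(1) d] assms(2) by auto
    moreover have "n = 0 \<or> n = 1 \<or> n = 2 \<or> n = 3 \<or> n = 4" using \<open>n \<le> 4\<close> by linarith
    ultimately show ?thesis by auto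
  qed
  moreover have "4 \<in> torsion_sums S" using card_triangles_in_torsion_sums[of S] assms by simp
  moreover have "-2 \<in> torsion_sums S" "-4 \<in> torsion_sums S"
    using torsion_sums_uminus calculation(2) assms(4) by blast+
  ultimately show ?thesis using assms by blast
qed

section \<open>Generators and computed invariants of the explicit groups\<close>

definition stats :: "code list \<Rightarrow> nat \<times> nat \<times> nat" where
  "stats xs = (length (filter (\<lambda>c. twist c = 0) xs),
     length (fixers_list 0 xs) + length (fixers_list 1 xs) + length (fixers_list 2 xs),
     length (triangles_list xs))"

definition essential_list :: "code list \<Rightarrow> bool" where
  "essential_list xs \<longleftrightarrow> distinct xs \<and> no_factor_list xs \<and> set (map twist xs) = {(0,0),(0,1),(1,0),(1,1)}"

abbreviation "T0_codes \<equiv> [Code (0,0) (0,0) (0,0) (1,0), Code (0,0) (0,0) (0,0) (0,1)]"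

definition "gens_27_3 = T0_codes @ [Code (0,0) (1,0) (1,0) (0,0), Code (1,0) (0,0) (1,0) (0,0)]"
definition "gens_17_5 = T0_codes @ [Code (1,0) (1,0) (0,0) (0,0), Code (0,1) (0,1) (0,0) (0,0), Code (1,0) (0,1) (1,0) (0,0)]"
definition "gens_15_3 = T0_codes @ [Code (0,0) (1,0) (1,0) (0,0), Code (1,0) (0,0) (1,0) (0,0), Code (0,1) (0,1) (0,1) (0,0)]"
definition "gens_15_3' = T0_codes @ [Code (0,0) (0,1) (1,0) (0,0), Code (0,1) (1,0) (0,0) (0,0),
   Code (1,0) (0,0) (0,1) (0,0), Code (1,0) (1,0) (1,0) (0,0)]"
text \<open>The remaining groups realise the pairs that nontrivial torsion yields elsewhere. In the last three the
  generator of sign part \<open>(-, +, -)\<close> is shifted so that no triangle closes up.\<close>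

definition "gens_12_6 = T0_codes @ [Code (0,0) (1,0) (1,0) (0,0), Code (1,0) (0,0) (0,1) (0,0), Code (0,1) (0,1) (0,0) (0,0)]"
definition "gens_15_15 = [Code (0,0) (0,0) (0,0) (1,0), Code (0,0) (0,0) (1,0) (0,1), Code (1,0) (1,0) (1,0) (0,0)]"
definition "gens_11_11 = [Code (0,0) (0,0) (0,0) (1,0), Code (0,0) (0,0) (0,1) (0,1), Code (1,0) (1,0) (0,0) (0,0)]"
definition "gens_9_9 = [Code (0,0) (0,0) (0,0) (1,0), Code (0,0) (0,0) (1,0) (0,1), Code (1,0) (1,0) (1,0) (0,0), Code (0,1) (0,1) (0,1) (0,0)]"

lemma stats_15_15: "essential_list (xor_span gens_15_15) \<and> stats (xor_span gens_15_15) = (2, 3, 0)"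
  by code_simp
lemma stats_11_11: "essential_list (xor_span gens_11_11) \<and> stats (xor_span gens_11_11) = (2, 2, 0)"
  by code_simp
lemma stats_9_9: "essential_list (xor_span gens_9_9) \<and> stats (xor_span gens_9_9) = (4, 3, 0)"
  by code_simp
lemma stats_12_6: "essential_list (xor_span gens_12_6) \<and> stats (xor_span gens_12_6) = (8, 6, 1)"
  by code_simp
text \<open>On a triangle \<open>sign_bit 1\<close> is 1 at \<open>g\<close> and 0 at
  \<open>h\<close>, so this wedge is -1 exactly when the shift of \<open>h\<close> in direction 0
  has first component 1. Here and in the next three groups this splits the triangles into equal
  halves, which gives torsion sum 0.\<close>

lemma stats_27_3: "essential_list (xor_span gens_27_3) \<and> stats (xor_span gens_27_3) = (4, 6, 2) \<and>
   (\<Sum>(g, h)\<leftarrow>triangles_list (xor_span gens_27_3). wedge (sign_bit 1) (\<lambda>c. fst (coord 0 c)) g h) = 0"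
  by code_simp
lemma stats_17_5: "essential_list (xor_span gens_17_5) \<and> stats (xor_span gens_17_5) = (8, 8, 2) \<and>
   (\<Sum>(g, h)\<leftarrow>triangles_list (xor_span gens_17_5). wedge (sign_bit 1) (\<lambda>c. fst (coord 0 c)) g h) = 0"
  by code_simp
lemma stats_15_3: "essential_list (xor_span gens_15_3) \<and> stats (xor_span gens_15_3) = (8, 6, 2) \<and>
   (\<Sum>(g, h)\<leftarrow>triangles_list (xor_span gens_15_3). wedge (sign_bit 1) (\<lambda>c. fst (coord 0 c)) g h) = 0"
  by code_simp
text \<open>As \<open>g\<close> has no shift in direction 0 and \<open>h\<close> none in direction
  1, the exponent of the second wedge is the product of one component of the shift of
  \<open>h\<close> and one of the shift of \<open>g\<close>. It is 1 on just one of the four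
  triangles, whence the sum 2.\<close>

lemma stats_15_3': "essential_list (xor_span gens_15_3') \<and> stats (xor_span gens_15_3') = (16, 12, 4) \<and>
   (\<Sum>(g, h)\<leftarrow>triangles_list (xor_span gens_15_3'). wedge (sign_bit 1) (\<lambda>c. fst (coord 0 c)) g h) = 0 \<and>
   (\<Sum>(g, h)\<leftarrow>triangles_list (xor_span gens_15_3'). wedge (\<lambda>c. snd (coord 0 c)) (\<lambda>c. fst (coord 1 c)) g h) = 2"
  by code_simp

section \<open>The elliptic curves\<close>

definition point_class :: "complex \<Rightarrow> complex \<Rightarrow> complex set" where
  "point_class t z = lattice_rel t `` {z}"

definition tors_point :: "complex \<Rightarrow> two_tors \<Rightarrow> complex" where
  "tors_point t x = of_bool (fst x = 1) + of_bool (snd x = 1) * t"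

definition unit_of_bit :: "bit \<Rightarrow> complex" where
  "unit_of_bit b = (if b = 0 then 1 else -1)"

lemma tors_point_0 [simp]: "tors_point t 0 = 0"
  by (simp add: tors_point_def)

lemma unit_of_bit_cases: "unit_of_bit b = 1 \<or> unit_of_bit b = -1"
  by (simp add: unit_of_bit_def)

lemma unit_of_bit_add: "unit_of_bit (b + c) = unit_of_bit b * unit_of_bit c"
  by (cases b; cases c) (simp_all add: unit_of_bit_def)

lemma point_class_eq_iff: "point_class t z = point_class t w \<longleftrightarrow> z - w \<in> lattice t"
  using eq_equiv_class_iff[OF equiv_lattice_rel, of z w t] by (simp add: point_class_def lattice_rel_def)

lemma ell_eq: "ell t = range (point_class t)"
  by (auto simp: ell_def quotient_def point_class_def)

lemma aff_point_class: "d = 1 \<or> d = -1 \<Longrightarrow> aff e d (point_class t z) = point_class t (d * z + e)"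
  unfolding point_class_def by (rule aff_class)

lemma latticeI: "z = 2 * of_int m + 2 * of_int n * t \<Longrightarrow> z \<in> lattice t"
  by (auto simp: lattice_def)

lemma two_int_comb_lattice: "2 * (of_int m + of_int n * t) \<in> lattice t"
  by (rule latticeI[of _ m n]) (simp add: algebra_simps)

lemma lattice_minus: "z \<in> lattice t \<Longrightarrow> w \<in> lattice t \<Longrightarrow> z - w \<in> lattice t"
proof -
  assume "z \<in> lattice t" "w \<in> lattice t"
  then obtain m n m' n' where "z = 2 * of_int m + 2 * of_int n * t" "w = 2 * of_int m' + 2 * of_int n' * t"
    by (auto simp: lattice_def)
  then show ?thesis by (intro latticeI[of _ "m - m'" "n - n'"]) (simp add: algebra_simps)
qed

lemma lattice_0: "0 \<in> lattice t"
  by (rule latticeI[of _ 0 0]) simp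

lemma lattice_uminus: "z \<in> lattice t \<Longrightarrow> - z \<in> lattice t"
  using lattice_minus[OF lattice_0] by simp

lemma lattice_add: "z \<in> lattice t \<Longrightarrow> w \<in> lattice t \<Longrightarrow> z + w \<in> lattice t"
  using lattice_minus[OF _ lattice_uminus] by simp

text \<open>The representatives are additive only modulo the lattice. In each component the error is
  an even integer, even when the second summand is negated.\<close>

lemma tors_point_add: "tors_point t (x + y) - (tors_point t x + unit_of_bit b * tors_point t y) \<in> lattice t"
proof -
  obtain m n :: int where "tors_point t (x + y) - (tors_point t x + unit_of_bit b * tors_point t y) = 2 * (of_int m + of_int n * t)"
  proof -
    have *: "\<exists>m::int. of_bool (u + v = 1) - (of_bool (u = 1) + unit_of_bit b * of_bool (v = 1)) = 2 * (of_int m :: complex)"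
      for u v :: bit
      by (cases u; cases v) (auto simp: unit_of_bit_def intro: exI[of _ 0] exI[of _ 1] exI[of _ "-1"])
    obtain m n where "of_bool (fst x + fst y = 1) - (of_bool (fst x = 1) + unit_of_bit b * of_bool (fst y = 1)) = 2 * (of_int m :: complex)"
      "of_bool (snd x + snd y = 1) - (of_bool (snd x = 1) + unit_of_bit b * of_bool (snd y = 1)) = 2 * (of_int n :: complex)"
      using *[of "fst x" "fst y"] *[of "snd x" "snd y"] by blast
    moreover have "tors_point t (x + y) - (tors_point t x + unit_of_bit b * tors_point t y) =
      (of_bool (fst x + fst y = 1) - (of_bool (fst x = 1) + unit_of_bit b * of_bool (fst y = 1))) +
      (of_bool (snd x + snd y = 1) - (of_bool (snd x = 1) + unit_of_bit b * of_bool (snd y = 1))) * t"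
      by (simp add: tors_point_def algebra_simps)
    ultimately show ?thesis using that[of m n] by (simp add: algebra_simps)
  qed
  then show ?thesis using two_int_comb_lattice by metis
qed

text \<open>Composition becomes addition of bits here: the sign of the outer map acts on the inner
  shift, which changes it only by a lattice vector.\<close>

lemma aff_add:
  assumes "A \<in> ell t"
  shows "aff (tors_point t (x + y)) (unit_of_bit (b + c)) A = aff (tors_point t x) (unit_of_bit b) (aff (tors_point t y) (unit_of_bit c) A)"
proof -
  obtain z where A: "A = point_class t z" using assms by (auto simp: ell_eq)
  have "unit_of_bit (b + c) * z + tors_point t (x + y) - (unit_of_bit b * (unit_of_bit c * z + tors_point t y) + tors_point t x) =
     tors_point t (x + y) - (tors_point t x + unit_of_bit b * tors_point t y)"
    unfolding unit_of_bit_add by (simp only: algebra_simps)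
  then show ?thesis
    unfolding A aff_point_class[OF unit_of_bit_cases] point_class_eq_iff by (simp only: tors_point_add)
qed

lemma aff_ell: "A \<in> ell t \<Longrightarrow> aff e (unit_of_bit b) A \<in> ell t"
  using aff_point_class[OF unit_of_bit_cases] by (auto simp: ell_eq)

lemma ell_topspace: "topspace (ell_topology t) = ell t"
proof -
  have "\<Union> (ell t) = UNIV"
    unfolding ell_def by (rule Union_quotient[OF equiv_lattice_rel])
  then have "openin (ell_topology t) (ell t)" by (simp add: openin_ell_topology)
  then show ?thesis by (metis openin_ell_topology openin_subset openin_topspace subset_antisym)
qed

lemma continuous_point_class: "continuous_map euclidean (ell_topology t) (point_class t)"
  unfolding continuous_map_def
proof (intro conjI allI impI)
  show "point_class t \<in> topspace euclidean \<rightarrow> topspace (ell_topology t)"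
    by (auto simp: ell_topspace ell_eq)
  fix U assume "openin (ell_topology t) U"
  then have U: "U \<subseteq> ell t" "open (\<Union> U)" by (simp_all add: openin_ell_topology)
  have "point_class t z \<in> U \<longleftrightarrow> z \<in> \<Union> U" for z
  proof
    have "z \<in> point_class t z" by (simp add: point_class_def lattice_rel_def lattice_0)
    then show "z \<in> \<Union> U" if "point_class t z \<in> U" using that by blast
    assume "z \<in> \<Union> U"
    then obtain w where "point_class t w \<in> U" "z \<in> point_class t w" using U by (auto simp: ell_eq)
    then show "point_class t z \<in> U"
      using equiv_class_eq[OF equiv_lattice_rel] by (simp add: point_class_def)
  qed
  then have "{z \<in> topspace euclidean. point_class t z \<in> U} = \<Union> U" by auto
  then show "openin euclidean {z \<in> topspace euclidean. point_class t z \<in> U}" using U by simp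
qed

lemma connected_space_ell: "connected_space (ell_topology t)"
proof -
  have "connectedin (ell_topology t) (point_class t ` UNIV)"
    by (rule connectedin_continuous_map_image[OF continuous_point_class])
      (simp add: convex_connected[OF convex_UNIV])
  then show ?thesis by (simp add: ell_eq[symmetric] ell_topspace[symmetric] connectedin_topspace)
qed

section \<open>Fixed points and their components on one curve\<close>

definition fixed_points :: "complex \<Rightarrow> two_tors \<Rightarrow> bit \<Rightarrow> complex set set" where
  "fixed_points t x b = {A \<in> ell t. aff (tors_point t x) (unit_of_bit b) A = A}"

context
  fixes t :: complex
  assumes t: "Im t \<noteq> 0"
begin

text \<open>The two expressions are half the real coordinates of \<open>z\<close> in the basis
  \<open>t\<close>, 1. They depend continuously on \<open>z\<close>, which yields closedness of the
  lattice.\<close>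

lemma lattice_iff:
  "z \<in> lattice t \<longleftrightarrow> Im z / Im t / 2 \<in> \<int> \<and> (Re z - Im z / Im t * Re t) / 2 \<in> \<int>"
proof
  assume "z \<in> lattice t"
  then obtain m n where "z = 2 * of_int m + 2 * of_int n * t" by (auto simp: lattice_def)
  then have "Im z / Im t / 2 = of_int n" "(Re z - Im z / Im t * Re t) / 2 = of_int m" using t by simp_all
  then show "Im z / Im t / 2 \<in> \<int> \<and> (Re z - Im z / Im t * Re t) / 2 \<in> \<int>" by simp
next
  assume "Im z / Im t / 2 \<in> \<int> \<and> (Re z - Im z / Im t * Re t) / 2 \<in> \<int>"
  then obtain m n where mn: "Im z / Im t / 2 = of_int n" "(Re z - Im z / Im t * Re t) / 2 = of_int m"
    by (metis Ints_cases)
  show "z \<in> lattice t"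
  proof (rule latticeI)
    have "Im z = 2 * of_int n * Im t" using mn(1) t by (simp add: field_simps)
    moreover have "Re z = 2 * of_int m + 2 * of_int n * Re t" using mn(2) unfolding calculation using t by (simp add: field_simps)
    ultimately show "z = 2 * of_int m + 2 * of_int n * t" by (simp add: complex_eq_iff)
  qed
qed

lemma closed_lattice: "closed (lattice t)"
proof -
  have "lattice t = (\<lambda>z. Im z / Im t / 2) -` \<int> \<inter> (\<lambda>z. (Re z - Im z / Im t * Re t) / 2) -` \<int>"
    by (auto simp: lattice_iff)
  moreover have "closed ((\<lambda>z. Im z / Im t / 2) -` \<int>)"
    by (rule closed_vimage) (auto intro!: continuous_intros simp: t)
  moreover have "closed ((\<lambda>z. (Re z - Im z / Im t * Re t) / 2) -` \<int>)"
    by (rule closed_vimage) (auto intro!: continuous_intros simp: t)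
  ultimately show ?thesis by (simp only: closed_Int)
qed

text \<open>Points of the quotient are closed because the lattice is. This makes finite fixed sets
  discrete, so that their components are single points.\<close>

lemma t1_space_ell: "t1_space (ell_topology t)"
  unfolding t1_space_closedin_singleton ell_topspace
proof
  fix A assume A: "A \<in> ell t"
  then obtain z where z: "A = point_class t z" by (auto simp: ell_eq)
  have "A = (\<lambda>w. z - w) -` lattice t"
    by (auto simp: z point_class_def lattice_rel_def)
  moreover have "closed ((\<lambda>w. z - w) -` lattice t)"
    by (rule closed_vimage[OF closed_lattice]) (auto intro!: continuous_intros)
  ultimately have "closed A" by simp
  moreover have "\<Union> (ell t - {A}) = - A"
  proof
    have "B \<inter> A = {}" if "B \<in> ell t - {A}" for B
      using quotient_disj[OF equiv_lattice_rel, of B t A] A that by (auto simp: ell_def)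
    then show "\<Union> (ell t - {A}) \<subseteq> - A" by fast
    have "\<Union> (ell t) = UNIV"
      unfolding ell_def by (rule Union_quotient[OF equiv_lattice_rel])
    then show "- A \<subseteq> \<Union> (ell t - {A})" by fast
  qed
  ultimately have "openin (ell_topology t) (ell t - {A})"
    by (simp add: openin_ell_topology open_Compl)
  then show "closedin (ell_topology t) {A}" using A by (simp add: closedin_def ell_topspace)
qed

lemma int_comb_lattice_iff: "of_int m + of_int n * t \<in> lattice t \<longleftrightarrow> even m \<and> even n"
proof -
  have "(of_int k / 2 :: real) \<in> \<int> \<longleftrightarrow> even k" for k :: int
  proof
    assume "(of_int k / 2 :: real) \<in> \<int>"
    then obtain l where "of_int k / 2 = (of_int l :: real)" by (metis Ints_cases)
    then have "(of_int k :: real) = of_int (2 * l)" by simp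
    then have "k = 2 * l" by (simp only: of_int_eq_iff)
    then show "even k" by simp
  qed (auto elim!: evenE)
  then show ?thesis using t by (auto simp: lattice_iff)
qed

lemma tors_point_diff_lattice_iff: "tors_point t x - tors_point t y \<in> lattice t \<longleftrightarrow> x = y"
proof -
  have "tors_point t x - tors_point t y = of_int (of_bool (fst x = 1) - of_bool (fst y = 1)) + of_int (of_bool (snd x = 1) - of_bool (snd y = 1)) * t"
    by (simp add: tors_point_def algebra_simps)
  then have "tors_point t x - tors_point t y \<in> lattice t \<longleftrightarrow>
      even (of_bool (fst x = 1) - of_bool (fst y = 1) :: int) \<and> even (of_bool (snd x = 1) - of_bool (snd y = 1) :: int)"
    by (simp only: int_comb_lattice_iff)
  also have "\<dots> \<longleftrightarrow> x = y"
    by (cases "fst x"; cases "fst y"; cases "snd x"; cases "snd y") (simp_all add: prod_eq_iff)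
  finally show ?thesis .
qed

lemma aff_eqD:
  assumes d: "d = 1 \<or> d = -1" "d' = 1 \<or> d' = -1" and eq: "\<And>A. A \<in> ell t \<Longrightarrow> aff e d A = aff e' d' A"
  shows "d = d'" "e - e' \<in> lattice t"
proof -
  have *: "d * z + e - (d' * z + e') \<in> lattice t" for z
    using eq[of "point_class t z"] d by (simp only: aff_point_class point_class_eq_iff ell_eq rangeI)
  show e: "e - e' \<in> lattice t" using *[of 0] by simp
  show "d = d'"
  proof (rule ccontr)
    assume "d \<noteq> d'"
    \<comment> \<open>Evaluation at 1/2 isolates the sign: for opposite signs the linear parts
      differ there by \<open>d\<close>, and neither 1 nor -1 lies in the lattice spanned by 2 and
      \<open>2 * t\<close>.\<close>
    then have "d * (1/2) + e - (d' * (1/2) + e') = d + (e - e')" using d by auto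
    then have "d \<in> lattice t" using lattice_minus[OF _ e] *[of "1/2"] by (metis add_diff_cancel_right')
    then show False using int_comb_lattice_iff[of 1 0] int_comb_lattice_iff[of "-1" 0] d by auto
  qed
qed

lemma fixed_points_0: "fixed_points t x 0 = (if x = 0 then ell t else {})"
proof -
  have "aff (tors_point t x) 1 A = A \<longleftrightarrow> x = 0" if "A \<in> ell t" for A
    using that tors_point_diff_lattice_iff[of x 0] by (auto simp: ell_eq aff_point_class point_class_eq_iff)
  then show ?thesis by (auto simp: fixed_points_def unit_of_bit_def)
qed

lemma point_class_fixed_points_1: "point_class t z \<in> fixed_points t x 1 \<longleftrightarrow> tors_point t x - 2 * z \<in> lattice t"
  by (simp add: fixed_points_def unit_of_bit_def ell_eq aff_point_class point_class_eq_iff) (simp add: algebra_simps)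

lemma fixed_points_1_nonempty: "fixed_points t x 1 \<noteq> {}"
  using point_class_fixed_points_1[of "tors_point t x / 2" x] lattice_0 by auto

lemma fixed_points_empty_iff: "fixed_points t x b = {} \<longleftrightarrow> b = 0 \<and> x \<noteq> 0"
  by (cases b) (auto simp: fixed_points_0 fixed_points_1_nonempty, auto simp: ell_eq)

text \<open>A fixed point is a solution of 2z = x modulo the lattice, and reducing the coefficients
  of the lattice vector modulo 2 leaves at most four classes.\<close>

lemma fixed_points_1_finite: "finite (fixed_points t x 1)"
proof -
  have "fixed_points t x 1 \<subseteq> (\<lambda>(m, n). point_class t (tors_point t x / 2 - (of_int m + of_int n * t))) ` ({0..1} \<times> {0..1 :: int})"
  proof
    fix A assume A: "A \<in> fixed_points t x 1"
    then obtain z where z: "A = point_class t z" by (auto simp: fixed_points_def ell_eq)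
    then obtain m n where mn: "tors_point t x - 2 * z = 2 * of_int m + 2 * of_int n * t"
      using A point_class_fixed_points_1 by (auto simp: lattice_def)
    have zz: "z = tors_point t x / 2 - (of_int m + of_int n * t)" using mn by (simp add: field_simps)
    have "z - (tors_point t x / 2 - (of_int (m mod 2) + of_int (n mod 2) * t)) = - (of_int (m - m mod 2) + of_int (n - n mod 2) * t)"
      unfolding zz by (simp add: algebra_simps)
    moreover have "\<dots> \<in> lattice t"
      by (rule lattice_uminus) (simp only: int_comb_lattice_iff, simp)
    ultimately have "A = point_class t (tors_point t x / 2 - (of_int (m mod 2) + of_int (n mod 2) * t))"
      unfolding z by (simp only: point_class_eq_iff)
    moreover have "(m mod 2, n mod 2) \<in> {0..1} \<times> {0..1}"
      using pos_mod_bound[of 2 m] pos_mod_bound[of 2 n] by auto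
    ultimately show "A \<in> (\<lambda>(m, n). point_class t (tors_point t x / 2 - (of_int m + of_int n * t))) ` ({0..1} \<times> {0..1 :: int})"
      by blast
  qed
  then show ?thesis by (rule finite_subset) simp
qed

lemma fixed_points_common: "A \<in> fixed_points t x 1 \<Longrightarrow> A \<in> fixed_points t y b \<longleftrightarrow> y = (if b = 1 then x else 0)"
proof (cases b)
  assume A: "A \<in> fixed_points t x 1"
  show "A \<in> fixed_points t y b \<longleftrightarrow> y = (if b = 1 then x else 0)" if "b = 0"
    using A that by (auto simp: fixed_points_0) (auto simp: fixed_points_def)
  show "A \<in> fixed_points t y b \<longleftrightarrow> y = (if b = 1 then x else 0)" if "b = 1"
  proof -
    obtain z where z: "A = point_class t z" using A by (auto simp: fixed_points_def ell_eq)
    have "tors_point t x - 2 * z \<in> lattice t" using A unfolding z point_class_fixed_points_1 .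
    then have "tors_point t y - 2 * z \<in> lattice t \<longleftrightarrow> tors_point t y - tors_point t x \<in> lattice t"
      using lattice_minus[of "tors_point t y - 2 * z" t "tors_point t x - 2 * z"] lattice_add[of "tors_point t y - tors_point t x" t "tors_point t x - 2 * z"]
      by (auto simp: algebra_simps)
    then show ?thesis unfolding that z point_class_fixed_points_1 by (simp add: tors_point_diff_lattice_iff)
  qed
qed

definition curve_components :: "two_tors \<Rightarrow> bit \<Rightarrow> complex set set set" where
  "curve_components x b = connected_components_of (subtopology (ell_topology t) (fixed_points t x b))"

lemma curve_components_0: "curve_components 0 0 = {ell t}"
proof -
  have "curve_components 0 0 = connected_components_of (ell_topology t)"
    by (simp add: curve_components_def fixed_points_0 subtopology_topspace flip: ell_topspace)
  moreover have "ell_topology t \<noteq> trivial_topology"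
    by (metis ell_eq ell_topspace empty_not_UNIV image_is_empty null_topspace_iff_trivial)
  ultimately show ?thesis
    by (simp add: connected_components_of_connected_space connected_space_ell ell_topspace)
qed

lemma curve_components_1: "curve_components x 1 = (\<lambda>A. {A}) ` fixed_points t x 1"
proof -
  have "subtopology (ell_topology t) (fixed_points t x 1) = discrete_topology (fixed_points t x 1)"
    by (intro finite_t1_space_imp_discrete_topology fixed_points_1_finite t1_space_subtopology t1_space_ell)
      (auto simp: ell_topspace fixed_points_def)
  then show ?thesis by (simp add: curve_components_def connected_components_of_discrete_topology)
qed

lemma curve_components_nonempty: "C \<in> curve_components x b \<Longrightarrow> C \<noteq> {}"
  unfolding curve_components_def by (rule nonempty_connected_components_of)

lemma curve_components_ell: "C \<in> curve_components x b \<Longrightarrow> C \<subseteq> ell t"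
  unfolding curve_components_def by (metis connected_components_of_subset ell_topspace topspace_subtopology_subset topspace_subtopology le_infE)

lemma curve_components_empty_iff: "curve_components x b = {} \<longleftrightarrow> fixed_points t x b = {}"
  unfolding curve_components_def connected_components_of_eq_empty
  by (auto simp: ell_topspace fixed_points_def simp flip: null_topspace_iff_trivial)

text \<open>For sign +1, existence of a component forces a trivial shift, and the component is the
  whole curve, which every affine map preserves. For sign -1 it is a single fixed point. The
  criterion is thus the same for all components.\<close>

lemma image_curve_components:
  assumes "C \<in> curve_components x b"
  shows "aff (tors_point t y) (unit_of_bit c) ` C = C \<longleftrightarrow> b = 0 \<or> y = (if c = 1 then x else 0)"
proof (cases "b = 0")
  case 0: True
  then have "x = 0" using assms curve_components_empty_iff[of x b] fixed_points_0[of x] by (auto split: if_splits)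
  then have "C = ell t" using assms curve_components_0 0 by auto
  then show ?thesis using aff_bij[OF unit_of_bit_cases] 0 by (auto simp: bij_betw_def)
next
  case False
  then have 1: "b = 1" by simp
  then obtain A where A: "C = {A}" "A \<in> fixed_points t x 1" using assms curve_components_1 by auto
  then have "aff (tors_point t y) (unit_of_bit c) ` C = C \<longleftrightarrow> A \<in> fixed_points t y c" by (auto simp: fixed_points_def)
  then show ?thesis using fixed_points_common[OF A(2)] 1 by simp
qed

end

section \<open>Self-maps of the threefold\<close>

lemma subgroup_BijGroup_inverse_free:
  assumes "H \<subseteq> carrier (BijGroup Y)" "\<one>\<^bsub>BijGroup Y\<^esub> \<in> H"
    and "\<And>a. a \<in> H \<Longrightarrow> a \<otimes>\<^bsub>BijGroup Y\<^esub> a = \<one>\<^bsub>BijGroup Y\<^esub>"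
    and "\<And>a b. a \<in> H \<Longrightarrow> b \<in> H \<Longrightarrow> a \<otimes>\<^bsub>BijGroup Y\<^esub> b \<in> H"
  shows "subgroup H (BijGroup Y)"
proof (rule group.subgroupI[OF group_BijGroup])
  show "inv\<^bsub>BijGroup Y\<^esub> a \<in> H" if "a \<in> H" for a
    using group.inv_equality[OF group_BijGroup assms(3)] that assms(1) by (simp add: subset_iff)
qed (use assms in auto)

locale tori =
  fixes t1 t2 t3 :: complex
  assumes t1: "Im t1 \<noteq> 0" and t2: "Im t2 \<noteq> 0" and t3: "Im t3 \<noteq> 0"
begin

abbreviation "\<tau> \<equiv> (t1, t2, t3)"
abbreviation "B \<equiv> BijGroup (X \<tau>)"

definition signs_of :: "code \<Rightarrow> triple" where
  "signs_of c = (unit_of_bit (sign_bit 0 c), unit_of_bit (sign_bit 1 c), unit_of_bit (sign_bit 2 c))"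

definition shift_of :: "code \<Rightarrow> triple" where
  "shift_of c = (tors_point t1 (coord 0 c), tors_point t2 (coord 1 c), tors_point t3 (coord 2 c))"

definition code_map :: "code \<Rightarrow> point \<Rightarrow> point" where
  "code_map c = mv \<tau> (shift_of c) (signs_of c)"

lemma signs_of_signs: "signs_of c \<in> signs"
  unfolding signs_of_def signs_def using unit_of_bit_cases by blast

lemma code_map_carrier: "code_map c \<in> carrier B"
  unfolding code_map_def by (rule mv_in_BijGroup[OF signs_of_signs])

lemma code_map_Bij: "code_map c \<in> Bij (X \<tau>)"
  using code_map_carrier by (simp add: BijGroup_def)

lemma code_map_apply:
  assumes "A1 \<in> ell t1" "A2 \<in> ell t2" "A3 \<in> ell t3"
  shows "code_map c (A1, A2, A3) =
    (aff (tors_point t1 (coord 0 c)) (unit_of_bit (sign_bit 0 c)) A1, aff (tors_point t2 (coord 1 c)) (unit_of_bit (sign_bit 1 c)) A2, aff (tors_point t3 (coord 2 c)) (unit_of_bit (sign_bit 2 c)) A3)"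
  using assms by (simp add: code_map_def mv_def X_def shift_of_def signs_of_def)

lemma code_map_add: "code_map (c + d) = code_map c \<otimes>\<^bsub>B\<^esub> code_map d"
proof -
  have "code_map (c + d) = compose (X \<tau>) (code_map c) (code_map d)"
  proof (rule extensionalityI[of _ "X \<tau>"])
    show "code_map (c + d) \<in> extensional (X \<tau>)" by (rule Bij_imp_extensional[OF code_map_Bij])
    fix P assume "P \<in> X \<tau>"
    then obtain A1 A2 A3 where "P = (A1, A2, A3)" "A1 \<in> ell t1" "A2 \<in> ell t2" "A3 \<in> ell t3"
      by (auto simp: X_def)
    then show "code_map (c + d) P = compose (X \<tau>) (code_map c) (code_map d) P"
      unfolding compose_def X_def by (simp only: code_map_apply aff_ell coord_add sign_bit_add aff_add restrict_apply mem_Times_iff) (simp add: code_map_apply aff_ell)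
  qed (simp add: compose_extensional)
  then show ?thesis by (simp add: BijGroup_def code_map_Bij)
qed

lemma code_map_double: "code_map c \<otimes>\<^bsub>B\<^esub> code_map c = code_map 0"
  by (simp flip: code_map_add)

text \<open>An idempotent in a group is the identity.\<close>

lemma code_map_0: "code_map 0 = \<one>\<^bsub>B\<^esub>"
  by (metis code_map_double[of 0] group.l_cancel_one group_BijGroup code_map_carrier)

lemma mv_eqD:
  assumes "d \<in> signs" "d' \<in> signs" and eq: "mv \<tau> e d = mv \<tau> e' d'"
  shows "d = d'" "fst e - fst e' \<in> lattice t1" "fst (snd e) - fst (snd e') \<in> lattice t2"
    "snd (snd e) - snd (snd e') \<in> lattice t3"
proof -
  obtain d1 d2 d3 d1' d2' d3' e1 e2 e3 e1' e2' e3' where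
    d: "d = (d1, d2, d3)" "d' = (d1', d2', d3')" "e = (e1, e2, e3)" "e' = (e1', e2', e3')"
    by (metis prod_cases3)
  have s: "d1 = 1 \<or> d1 = -1" "d2 = 1 \<or> d2 = -1" "d3 = 1 \<or> d3 = -1"
    "d1' = 1 \<or> d1' = -1" "d2' = 1 \<or> d2' = -1" "d3' = 1 \<or> d3' = -1"
    using assms(1,2) by (auto simp: d signs_def)
  have *: "aff e1 d1 A1 = aff e1' d1' A1 \<and> aff e2 d2 A2 = aff e2' d2' A2 \<and> aff e3 d3 A3 = aff e3' d3' A3"
    if "A1 \<in> ell t1" "A2 \<in> ell t2" "A3 \<in> ell t3" for A1 A2 A3
    using fun_cong[OF eq, of "(A1, A2, A3)"] that by (simp add: mv_def X_def d)
  have ne: "point_class t 0 \<in> ell t" for t by (simp add: ell_eq)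
  have "d1 = d1'" "e1 - e1' \<in> lattice t1"
    using aff_eqD[OF t1 s(1,4)] * ne by blast+
  moreover have "d2 = d2'" "e2 - e2' \<in> lattice t2"
    using aff_eqD[OF t2 s(2,5)] * ne by blast+
  moreover have "d3 = d3'" "e3 - e3' \<in> lattice t3"
    using aff_eqD[OF t3 s(3,6)] * ne by blast+
  ultimately show "d = d'" "fst e - fst e' \<in> lattice t1" "fst (snd e) - fst (snd e') \<in> lattice t2"
    "snd (snd e) - snd (snd e') \<in> lattice t3"
    by (simp_all add: d)
qed

lemma unit_of_bit_inject: "unit_of_bit b = unit_of_bit c \<longleftrightarrow> b = c"
  by (cases b; cases c) (simp_all add: unit_of_bit_def)

lemma signs_of_eq_iff: "signs_of c = signs_of d \<longleftrightarrow> twist c = twist d"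
  by (cases c; cases d) (auto simp: signs_of_def unit_of_bit_inject sign_bit_def)

lemma inj_code_map: "inj code_map"
proof (rule injI)
  fix c d assume "code_map c = code_map d"
  note mv_eqD[OF signs_of_signs signs_of_signs this[unfolded code_map_def]]
  then show "c = d"
    using t1 t2 t3 by (intro code_eqI[of 0 1 2]) (simp_all add: index_perm_def signs_of_eq_iff shift_of_def tors_point_diff_lattice_iff)
qed

lemma code_map_eq_iff: "code_map c = code_map d \<longleftrightarrow> c = d"
  using inj_code_map by (simp add: inj_eq)

lemma subgroup_code_map:
  assumes "0 \<in> S" "\<And>a b. a \<in> S \<Longrightarrow> b \<in> S \<Longrightarrow> a + b \<in> S"
  shows "subgroup (code_map ` S) B"
proof (rule subgroup_BijGroup_inverse_free)
  show "\<one>\<^bsub>B\<^esub> \<in> code_map ` S" using assms(1) code_map_0 by (metis imageI)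
  show "a \<otimes>\<^bsub>B\<^esub> b \<in> code_map ` S" if "a \<in> code_map ` S" "b \<in> code_map ` S" for a b
    using that assms(2) by (auto simp flip: code_map_add)
qed (auto simp: code_map_carrier code_map_double code_map_0)

lemma generate_code_map: "generate B (code_map ` set as) = code_map ` set (xor_span as)"
proof
  have "code_map ` set as \<subseteq> code_map ` set (xor_span as)" using gens_in_xor_span by blast
  then show "generate B (code_map ` set as) \<subseteq> code_map ` set (xor_span as)"
    by (rule group.generate_subgroup_incl[OF group_BijGroup])
      (rule subgroup_code_map[OF zero_in_xor_span xor_span_add])
  show "code_map ` set (xor_span as) \<subseteq> generate B (code_map ` set as)"
  proof (induction as)
    case (Cons a as)
    have le: "generate B (code_map ` set as) \<subseteq> generate B (code_map ` set (a # as))"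
      by (rule group.mono_generate[OF group_BijGroup]) auto
    have "code_map (a + c) \<in> generate B (code_map ` set (a # as))" if "c \<in> set (xor_span as)" for c
      unfolding code_map_add
    proof (rule generate.eng)
      show "code_map a \<in> generate B (code_map ` set (a # as))" by (rule generate.incl) simp
      show "code_map c \<in> generate B (code_map ` set (a # as))" using that Cons le by blast
    qed
    then show ?case using Cons le by auto
  qed (simp add: code_map_0 generate.one)
qed

text \<open>The maps act factor by factor, and the components of a product space are the products of
  components of the factors.\<close>

lemma fixed_locus_components_code_map:
  "fixed_locus \<tau> (code_map c) = fixed_points t1 (coord 0 c) (sign_bit 0 c) \<times> fixed_points t2 (coord 1 c) (sign_bit 1 c) \<times> fixed_points t3 (coord 2 c) (sign_bit 2 c)"
  "fixed_components \<tau> (code_map c) = {C1 \<times> C2 \<times> C3 | C1 C2 C3. C1 \<in> curve_components t1 (coord 0 c) (sign_bit 0 c) \<and>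
     C2 \<in> curve_components t2 (coord 1 c) (sign_bit 1 c) \<and> C3 \<in> curve_components t3 (coord 2 c) (sign_bit 2 c)}"
proof -
  show fl: "fixed_locus \<tau> (code_map c) = fixed_points t1 (coord 0 c) (sign_bit 0 c) \<times> fixed_points t2 (coord 1 c) (sign_bit 1 c) \<times> fixed_points t3 (coord 2 c) (sign_bit 2 c)"
    by (auto simp: fixed_locus_def X_def code_map_apply fixed_points_def)
  show "fixed_components \<tau> (code_map c) = {C1 \<times> C2 \<times> C3 | C1 C2 C3. C1 \<in> curve_components t1 (coord 0 c) (sign_bit 0 c) \<and>
     C2 \<in> curve_components t2 (coord 1 c) (sign_bit 1 c) \<and> C3 \<in> curve_components t3 (coord 2 c) (sign_bit 2 c)}"
    unfolding fixed_components_def fl X_topology_def prod.case subtopology_Times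
      connected_components_of_prod_topology curve_components_def[OF t1] curve_components_def[OF t2] curve_components_def[OF t3]
    by blast
qed

lemma fixed_locus_empty_iff:
  "fixed_locus \<tau> (code_map c) = {} \<longleftrightarrow> (\<exists>i<3. sign_bit i c = 0 \<and> coord i c \<noteq> 0)"
  using t1 t2 t3 all_index_perm[of 0 1 2 "\<lambda>i. \<not> (sign_bit i c = 0 \<and> coord i c \<noteq> 0)"]
  by (auto simp: fixed_locus_components_code_map fixed_points_empty_iff index_perm_def)

lemma fixed_components_nonempty:
  assumes "fixed_locus \<tau> (code_map c) \<noteq> {}"
  shows "fixed_components \<tau> (code_map c) \<noteq> {}"
proof -
  have "fixed_points t1 (coord 0 c) (sign_bit 0 c) \<noteq> {}" "fixed_points t2 (coord 1 c) (sign_bit 1 c) \<noteq> {}" "fixed_points t3 (coord 2 c) (sign_bit 2 c) \<noteq> {}"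
    using assms by (auto simp: fixed_locus_components_code_map)
  then have "curve_components t1 (coord 0 c) (sign_bit 0 c) \<noteq> {}" "curve_components t2 (coord 1 c) (sign_bit 1 c) \<noteq> {}" "curve_components t3 (coord 2 c) (sign_bit 2 c) \<noteq> {}"
    using curve_components_empty_iff t1 t2 t3 by blast+
  then show ?thesis by (auto simp: fixed_locus_components_code_map)
qed

text \<open>The right-hand side does not mention \<open>C\<close>, so all components have the same
  stabilizer. This settles the case distinction in \<open>contribution\<close>.\<close>

lemma image_fixed_component:
  assumes "C \<in> fixed_components \<tau> (code_map g)"
  shows "code_map h ` C = C \<longleftrightarrow> stabilizes g h"
proof -
  obtain C1 C2 C3 where C: "C = C1 \<times> C2 \<times> C3" and
    C1: "C1 \<in> curve_components t1 (coord 0 g) (sign_bit 0 g)" and C2: "C2 \<in> curve_components t2 (coord 1 g) (sign_bit 1 g)" and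
    C3: "C3 \<in> curve_components t3 (coord 2 g) (sign_bit 2 g)"
    using assms by (auto simp: fixed_locus_components_code_map)
  have sub: "C1 \<subseteq> ell t1" "C2 \<subseteq> ell t2" "C3 \<subseteq> ell t3"
    using C1 C2 C3 curve_components_ell t1 t2 t3 by blast+
  have ne: "C1 \<noteq> {}" "C2 \<noteq> {}" "C3 \<noteq> {}"
    using C1 C2 C3 curve_components_nonempty t1 t2 t3 by blast+
  let ?f1 = "aff (tors_point t1 (coord 0 h)) (unit_of_bit (sign_bit 0 h))" and ?f2 = "aff (tors_point t2 (coord 1 h)) (unit_of_bit (sign_bit 1 h))"
    and ?f3 = "aff (tors_point t3 (coord 2 h)) (unit_of_bit (sign_bit 2 h))"
  have "code_map h ` C = map_prod ?f1 (map_prod ?f2 ?f3) ` C"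
    unfolding C using sub by (intro image_cong[OF refl]) (auto simp: code_map_apply subset_iff)
  also have "\<dots> = (?f1 ` C1) \<times> (?f2 ` C2) \<times> (?f3 ` C3)"
    unfolding C by (simp add: map_prod_surj_on)
  \<comment> \<open>A product of nonempty sets determines its factors.\<close>
  finally have "code_map h ` C = C \<longleftrightarrow> ?f1 ` C1 = C1 \<and> ?f2 ` C2 = C2 \<and> ?f3 ` C3 = C3"
    using ne unfolding C by (simp add: times_eq_iff)
  also have "\<dots> \<longleftrightarrow> stabilizes g h"
    unfolding stabilizes_def all_index_perm[of 0 1 2, simplified index_perm_def, simplified]
      image_curve_components[OF t1 C1] image_curve_components[OF t2 C2] image_curve_components[OF t3 C3] by auto
  finally show ?thesis .
qed

end

section \<open>Hodge pairs\<close>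

definition hodge_of :: "nat \<Rightarrow> nat \<Rightarrow> int \<Rightarrow> rat \<times> rat" where
  "hodge_of v s d = (3 + 8 / of_nat v * (of_nat s + 3 * of_int d), 3 + 8 / of_nat v * (of_nat s - 3 * of_int d))"

lemma UNIV_two_tors: "(UNIV :: two_tors set) = {(0, 0), (0, 1), (1, 0), (1, 1)}"
  by (auto simp: UNIV_bit simp flip: UNIV_Times_UNIV)

lemma Collect_image: "{y \<in> f ` A. P y} = f ` {x \<in> A. P (f x)}"
  by blast

lemma hodge_of_uminus: "hodge_of v s (- d) = prod.swap (hodge_of v s d)"
  by (simp add: hodge_of_def)

lemma sum_pair:
  fixes q :: rat
  assumes "finite A"
  shows "(\<Sum>g\<in>A. (q * (1 + f g), q * (1 - f g))) = (q * (of_nat (card A) + sum f A), q * (of_nat (card A) - sum f A))"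
  using assms by (induction A rule: finite_induct) (auto simp: algebra_simps zero_prod_def)

definition fixer_total :: "code set \<Rightarrow> nat" where
  "fixer_total S = card (fixers 0 S) + card (fixers 1 S) + card (fixers 2 S)"

context tori
begin

lemma rank_code_map:
  assumes "card (transls S) = 2 ^ r"
  shows "rank \<tau> (code_map ` S) = r"
proof -
  have "translation_subgroup \<tau> (code_map ` S) = code_map ` transls S"
  proof (intro equalityI subsetI)
    fix g assume "g \<in> translation_subgroup \<tau> (code_map ` S)"
    then obtain c e where c: "g = code_map c" "c \<in> S" "code_map c = transl \<tau> e"
      by (auto simp: translation_subgroup_def)
    have "signs_of c = (1, 1, 1)"
      using mv_eqD(1)[OF signs_of_signs _ c(3)[unfolded code_map_def]] by (simp add: signs_def)
    then have "twist c = 0" using signs_of_eq_iff[of c 0] by (simp add: signs_of_def unit_of_bit_def)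
    then have "c \<in> transls S" using c(2) by (simp add: transls_def)
    then show "g \<in> code_map ` transls S" unfolding c(1) by (rule imageI)
  next
    fix g assume "g \<in> code_map ` transls S"
    then obtain c where c: "g = code_map c" "c \<in> S" "twist c = 0" by (auto simp: transls_def)
    have "signs_of c = (1, 1, 1)" using signs_of_eq_iff[of c 0] c by (simp add: signs_of_def unit_of_bit_def)
    then have "g = transl \<tau> (shift_of c)" using c by (simp add: code_map_def)
    moreover have "g \<in> code_map ` S" unfolding c(1) using c(2) by (rule imageI)
    ultimately show "g \<in> translation_subgroup \<tau> (code_map ` S)" unfolding translation_subgroup_def by blast
  qed
  then have "card (translation_subgroup \<tau> (code_map ` S)) = 2 ^ r"
    using assms by (simp add: card_image inj_on_subset[OF inj_code_map])
  then show ?thesis unfolding rank_def by (intro the_equality) simp_all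
qed

lemma generate_singleton: "generate B {code_map g} = code_map ` {0, g}"
  using generate_code_map[of "[g]"] by simp

text \<open>One formula covers all three cases: \<open>d\<close> is 0 without a partner and
  otherwise the torsion sign on it. By uniqueness of partners the sum defining \<open>d\<close> has
  at most one term.\<close>

lemma contribution_code_map:
  assumes S: "essential_code S" and p: "index_perm i j k" and g: "g \<in> fixers i S"
    and alt: "alternating S (\<lambda>a b. \<epsilon> (code_map a) (code_map b))"
  defines "q \<equiv> 8 / of_nat (card (transls S)) :: rat"
    and "d \<equiv> of_int (\<Sum>h | h \<in> fixers j S \<and> g + h \<in> fixers k S. \<epsilon> (code_map g) (code_map h)) :: rat"
  shows "contribution \<tau> (code_map ` S) \<epsilon> (code_map g) = (q * (1 + d), q * (1 - d))"
proof -
  interpret essential_code S by fact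
  obtain r where r: "card (transls S) = 2 ^ r" using card_transls_power by blast
  have q: "2 powi (3 - int (rank \<tau> (code_map ` S))) = q" "2 powi (4 - int (rank \<tau> (code_map ` S))) = 2 * q"
    unfolding rank_code_map[OF r] q_def r by (simp_all add: power_int_diff)
  have gS: "g \<in> S" and gi: "sign_bit i g = 0" "sign_bit j g = 1" "sign_bit k g = 1" "coord i g = 0"
    using g fixers_iff[OF p] by auto
  have comps: "fixed_components \<tau> (code_map g) \<noteq> {}"
  proof (rule fixed_components_nonempty)
    have "\<forall>l<3. \<not> (sign_bit l g = 0 \<and> coord l g \<noteq> 0)" unfolding all_index_perm[OF p] using gi by simp
    then show "fixed_locus \<tau> (code_map g) \<noteq> {}" unfolding fixed_locus_empty_iff by blast
  qed
  have stabilizes0: "stabilizes g 0" "stabilizes g g" by (simp_all add: stabilizes_def)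
  have stabilizer: "stabilizer (code_map ` S) C = code_map ` {h \<in> S. stabilizes g h}" if "C \<in> fixed_components \<tau> (code_map g)" for C
    using image_fixed_component[OF that] by (auto simp: stabilizer_def)
  have all: "(\<forall>C\<in>fixed_components \<tau> (code_map g). stabilizer (code_map ` S) C = generate B {code_map g}) \<longleftrightarrow> {h \<in> S. stabilizes g h} = {0, g}"
  proof -
    have "(\<forall>C\<in>fixed_components \<tau> (code_map g). stabilizer (code_map ` S) C = generate B {code_map g}) \<longleftrightarrow>
        (\<forall>C\<in>fixed_components \<tau> (code_map g). {h \<in> S. stabilizes g h} = {0, g})"
      unfolding generate_singleton
      by (rule ball_cong[OF refl]) (simp only: stabilizer inj_image_eq_iff[OF inj_code_map])
    then show ?thesis using comps by blast
  qed
  show ?thesis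
  proof (cases "{h \<in> S. stabilizes g h} = {0, g}")
    case True
    then have "{h. h \<in> fixers j S \<and> g + h \<in> fixers k S} = {}"
      using partner_iff[OF p g] by blast
    then have "d = 0" unfolding d_def by (simp only: sum.empty of_int_0)
    moreover have "\<forall>C\<in>fixed_components \<tau> (code_map g). stabilizer (code_map ` S) C = generate B {code_map g}"
      using True all by blast
    ultimately show ?thesis unfolding contribution_def Let_def q by simp
  next
    case False
    let ?P = "\<lambda>h. h \<in> code_map ` S \<and> h \<notin> generate B {code_map g} \<and> (\<forall>C\<in>fixed_components \<tau> (code_map g). h ` C = C)"
    obtain h0 where "h0 \<in> S" "stabilizes g h0" "h0 \<notin> {0, g}"
      using False stabilizes0 zero gS by blast
    then have "?P (code_map h0)"
      unfolding generate_singleton using image_fixed_component by (auto simp: code_map_eq_iff)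
    then have P: "?P (SOME h. ?P h)" by (rule someI[where P = ?P])
    then have "(SOME h. ?P h) \<in> code_map ` S" by (rule conjunct1)
    then obtain h where h: "(SOME h. ?P h) = code_map h" "h \<in> S" by (rule imageE)
    have Ph: "?P (code_map h)" using P unfolding h(1) .
    obtain C where C: "C \<in> fixed_components \<tau> (code_map g)" using comps by (metis ex_in_conv)
    then have "code_map h ` C = C" using Ph by (elim conjE) (erule (1) bspec)
    then have "stabilizes g h" using image_fixed_component[OF C] by (rule iffD1[rotated])
    moreover have "h \<notin> {0, g}" using Ph unfolding generate_singleton by (metis imageI)
    ultimately have "(h \<in> fixers j S \<and> g + h \<in> fixers k S) \<or> (g + h \<in> fixers j S \<and> h \<in> fixers k S)"
      using partner_iff[OF p g, of h] h by blast
    \<comment> \<open>The choice operator may return either of the two partners. Only the one in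
      \<open>fixers j S\<close> enters the sum, and the torsion agrees on both.\<close>
    then obtain h' where h': "h' \<in> fixers j S" "g + h' \<in> fixers k S" "h' = h \<or> h' = g + h"
      by (metis code_double_left)
    then have "{h. h \<in> fixers j S \<and> g + h \<in> fixers k S} = {h'}"
      using partner_unique[OF p] by blast
    then have d: "d = of_int (\<epsilon> (code_map g) (code_map h'))" unfolding d_def by simp
    have "\<epsilon> (code_map g) (code_map h') = \<epsilon> (code_map g) (code_map h)"
      using h'(3) alternating_add_self[OF alt gS h(2)] by auto
    moreover have "\<epsilon> (code_map g) (code_map h) = 1 \<or> \<epsilon> (code_map g) (code_map h) = -1"
      using alt gS h(2) unfolding alternating_def by blast
    moreover have "\<not> (\<forall>C\<in>fixed_components \<tau> (code_map g). stabilizer (code_map ` S) C = generate B {code_map g})"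
      using False all by blast
    ultimately show ?thesis unfolding contribution_def Let_def q h(1) d by auto
  qed
qed

text \<open>The nontrivial elements with fixed points are the disjoint union of the three sets of
  fixers, and each of the three partial sums involves the same torsion sum.\<close>

lemma hodge_pair_code_map:
  assumes S: "essential_code S" and alt: "alternating S (\<lambda>a b. \<epsilon> (code_map a) (code_map b))"
  shows "hodge_pair \<tau> (code_map ` S) \<epsilon> =
    hodge_of (card (transls S)) (fixer_total S) (torsion_sum S (\<lambda>a b. \<epsilon> (code_map a) (code_map b)))"
proof -
  interpret essential_code S by fact
  define q :: rat where "q = 8 / of_nat (card (transls S))"
  define D where "D = torsion_sum S (\<lambda>a b. \<epsilon> (code_map a) (code_map b))"
  have p: "index_perm 0 1 2" "index_perm 1 0 2" "index_perm 2 0 1" by (simp_all add: index_perm_def)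
  have U: "{g \<in> code_map ` S. g \<noteq> \<one>\<^bsub>B\<^esub> \<and> fixed_locus \<tau> g \<noteq> {}} = code_map ` (fixers 0 S \<union> fixers 1 S \<union> fixers 2 S)"
  proof -
    have iff: "c \<noteq> 0 \<and> \<not> (\<exists>i<3. sign_bit i c = 0 \<and> coord i c \<noteq> 0) \<longleftrightarrow> c \<in> fixers 0 S \<union> fixers 1 S \<union> fixers 2 S" if c: "c \<in> S" for c
    proof -
      have *: "\<not> (\<exists>i<3. sign_bit i c = 0 \<and> coord i c \<noteq> 0) \<longleftrightarrow>
          (sign_bit 0 c = 0 \<longrightarrow> coord 0 c = 0) \<and> (sign_bit 1 c = 0 \<longrightarrow> coord 1 c = 0) \<and> (sign_bit 2 c = 0 \<longrightarrow> coord 2 c = 0)"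
        using all_index_perm[OF p(1), of "\<lambda>i. \<not> (sign_bit i c = 0 \<and> coord i c \<noteq> 0)"] by blast
      have z: "c = 0" if "twist c = 0" "coord 0 c = 0" "coord 1 c = 0" "coord 2 c = 0"
        using that by (intro code_eqI[OF p(1)]) simp_all
      have nz: "twist c \<noteq> 0" if "c \<in> fixers i S" for i
        using that by (simp add: fixers_def)
      show ?thesis
        unfolding *
        using z sign_bit_third[OF p(1), of c] twist_zero_iff[OF p(1), of c] c
        unfolding Un_iff fixers_iff[OF p(1)] fixers_iff[OF p(2)] fixers_iff[OF p(3)]
        by (cases "sign_bit 0 c"; cases "sign_bit 1 c") auto
    qed
    have "{c \<in> S. c \<noteq> 0 \<and> \<not> (\<exists>i<3. sign_bit i c = 0 \<and> coord i c \<noteq> 0)} = fixers 0 S \<union> fixers 1 S \<union> fixers 2 S"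
    proof (rule Set.set_eqI)
      fix c
      show "c \<in> {c \<in> S. c \<noteq> 0 \<and> \<not> (\<exists>i<3. sign_bit i c = 0 \<and> coord i c \<noteq> 0)} \<longleftrightarrow> c \<in> fixers 0 S \<union> fixers 1 S \<union> fixers 2 S"
        using iff[of c] fixers_subset[of 0] fixers_subset[of 1] fixers_subset[of 2] by (cases "c \<in> S") blast+
    qed
    moreover have "{g \<in> code_map ` S. g \<noteq> \<one>\<^bsub>B\<^esub> \<and> fixed_locus \<tau> g \<noteq> {}} =
        code_map ` {c \<in> S. code_map c \<noteq> code_map 0 \<and> fixed_locus \<tau> (code_map c) \<noteq> {}}"
      unfolding code_map_0[symmetric] by (rule Collect_image)
    ultimately show ?thesis by (simp only: fixed_locus_empty_iff code_map_eq_iff simp_thms)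
  qed
  have disj: "fixers 0 S \<inter> fixers 1 S = {}" "(fixers 0 S \<union> fixers 1 S) \<inter> fixers 2 S = {}"
    using fixers_iff[OF p(1)] fixers_iff[OF p(2)] fixers_iff[OF p(3)] by auto
  have part: "(\<Sum>g\<in>fixers i S. contribution \<tau> (code_map ` S) \<epsilon> (code_map g)) =
      (q * (of_nat (card (fixers i S)) + of_int D), q * (of_nat (card (fixers i S)) - of_int D))"
    if pi: "index_perm i j k" and D: "(\<Sum>g\<in>fixers i S. \<Sum>h | h \<in> fixers j S \<and> g + h \<in> fixers k S. \<epsilon> (code_map g) (code_map h)) = D" for i j k
    using contribution_code_map[OF S pi _ alt] sum_pair[of "fixers i S" q] D[symmetric]
    unfolding q_def by simp
  have "(\<Sum>g\<in>code_map ` (fixers 0 S \<union> fixers 1 S \<union> fixers 2 S). contribution \<tau> (code_map ` S) \<epsilon> g) =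
    (\<Sum>g\<in>fixers 0 S. contribution \<tau> (code_map ` S) \<epsilon> (code_map g)) + (\<Sum>g\<in>fixers 1 S. contribution \<tau> (code_map ` S) \<epsilon> (code_map g)) +
    (\<Sum>g\<in>fixers 2 S. contribution \<tau> (code_map ` S) \<epsilon> (code_map g))"
    by (simp only: sum.reindex[OF inj_on_subset[OF inj_code_map subset_UNIV]] o_def
        sum.union_disjoint[OF finite finite disj(1)] sum.union_disjoint[OF finite finite disj(2)])
  also have "\<dots> = (q * (of_nat (fixer_total S) + 3 * of_int D), q * (of_nat (fixer_total S) - 3 * of_int D))"
    unfolding part[OF p(1) sum_partner_0[of "\<lambda>a b. \<epsilon> (code_map a) (code_map b)", folded D_def]]
      part[OF p(2) sum_partner_1[OF alt, folded D_def]] part[OF p(3) sum_partner_2[OF alt, folded D_def]]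
      fixer_total_def
    by (simp add: algebra_simps)
  finally show ?thesis
    unfolding hodge_pair_def U hodge_of_def D_def q_def by simp
qed

section \<open>Hodge pairs attained by the image of a code group\<close>

lemma discrete_torsion_code_map:
  assumes "essential_code S"
  shows "discrete_torsion \<tau> (code_map ` S) \<epsilon> \<longleftrightarrow> alternating S (\<lambda>a b. \<epsilon> (code_map a) (code_map b))"
  unfolding discrete_torsion_def alternating_def by (simp add: code_map_add)

lemma hodge_values_code_map:
  assumes S: "essential_code S"
  shows "hodge_values \<tau> (code_map ` S) = hodge_of (card (transls S)) (fixer_total S) ` torsion_sums S"
proof (intro equalityI subsetI)
  fix x assume "x \<in> hodge_values \<tau> (code_map ` S)"
  then obtain \<epsilon> where e: "x = hodge_pair \<tau> (code_map ` S) \<epsilon>" "alternating S (\<lambda>a b. \<epsilon> (code_map a) (code_map b))"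
    by (auto simp: hodge_values_def discrete_torsion_code_map[OF S])
  then have "torsion_sum S (\<lambda>a b. \<epsilon> (code_map a) (code_map b)) \<in> torsion_sums S" unfolding torsion_sums_def by blast
  then show "x \<in> hodge_of (card (transls S)) (fixer_total S) ` torsion_sums S"
    unfolding e(1) hodge_pair_code_map[OF S e(2)] by blast
next
  fix x assume "x \<in> hodge_of (card (transls S)) (fixer_total S) ` torsion_sums S"
  then obtain \<epsilon> where e: "x = hodge_of (card (transls S)) (fixer_total S) (torsion_sum S \<epsilon>)" "alternating S \<epsilon>"
    by (auto simp: torsion_sums_def)
  \<comment> \<open>Torsion on codes is carried to maps along the inverse of the injective
    \<open>code_map\<close>.\<close>
  let ?e = "\<lambda>g h. \<epsilon> (inv_into UNIV code_map g) (inv_into UNIV code_map h)"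
  have "(\<lambda>a b. ?e (code_map a) (code_map b)) = \<epsilon>" by (simp add: inv_f_f[OF inj_code_map])
  then have "discrete_torsion \<tau> (code_map ` S) ?e" "x = hodge_pair \<tau> (code_map ` S) ?e"
    using e discrete_torsion_code_map[OF S, of ?e] hodge_pair_code_map[OF S, of ?e] by simp_all
  then show "x \<in> hodge_values \<tau> (code_map ` S)" unfolding hodge_values_def by blast
qed

lemma hodge_pair_trivial:
  "essential_code S \<Longrightarrow> hodge_pair \<tau> (code_map ` S) trivial_torsion =
    hodge_of (card (transls S)) (fixer_total S) (int (card (triangles S)))"
  using hodge_pair_code_map[OF _ alternating_one] by (simp add: torsion_sum_one)

section \<open>Generated and essential groups in coordinates\<close>

lemma code_map_translation: "twist c = 0 \<Longrightarrow> code_map c = transl \<tau> (shift_of c)"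
  using signs_of_eq_iff[of c 0] by (simp add: code_map_def signs_of_def unit_of_bit_def)

lemma code_map_T0_codes:
  "{mv \<tau> (0, 0, 0) (1, -1, -1), mv \<tau> (0, 0, 0) (-1, 1, -1)} = code_map ` set T0_codes"
  by (simp add: code_map_def shift_of_def signs_of_def coord_def sign_bit_def unit_of_bit_def tors_point_def)

lemma T0_with_code_map:
  assumes "\<forall>c\<in>set as. twist c = 0"
  shows "T0_with \<tau> (shift_of ` set as) = code_map ` set (xor_span (T0_codes @ as))"
proof -
  have "transl \<tau> ` shift_of ` set as = code_map ` set as"
    using assms by (auto simp: code_map_translation image_image intro!: image_cong)
  then show ?thesis
    unfolding T0_with_def code_map_T0_codes by (simp only: generate_code_map image_Un[symmetric] set_append[symmetric])
qed

lemma T0_code_map: "T0 \<tau> = code_map ` range (Code 0 0 0)"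
proof -
  have "set (xor_span T0_codes) = range (Code 0 0 0)"
    by (simp add: UNIV_two_tors zero_code_def zero_prod_def insert_commute)
  then show ?thesis unfolding T0_def code_map_T0_codes generate_code_map by simp
qed

lemma two_torsion_eq: "two_torsion t = range (tors_point t)"
  by (simp add: UNIV_two_tors two_torsion_def tors_point_def insert_commute)

text \<open>Each code is the sum of a pure translation and a pure twist, and both kinds occur in the
  generating set.\<close>

lemma Gmax_code_map: "Gmax \<tau> = range code_map"
proof
  let ?H = "T0 \<tau> \<union> transl \<tau> ` (two_torsion t1 \<times> two_torsion t2 \<times> two_torsion t3)"
  have tr: "transl \<tau> (tors_point t1 x, tors_point t2 y, tors_point t3 z) = code_map (Code x y z 0)" for x y z
    by (subst code_map_translation) (simp_all add: shift_of_def coord_def)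
  have H: "?H = code_map ` range (Code 0 0 0) \<union> range (\<lambda>(x, y, z). code_map (Code x y z 0))"
  proof -
    have "range (tors_point t1) \<times> range (tors_point t2) \<times> range (tors_point t3) = range (\<lambda>(x, y, z). (tors_point t1 x, tors_point t2 y, tors_point t3 z))"
      by (simp add: map_prod_surj_on[symmetric] map_prod_def case_prod_unfold flip: UNIV_Times_UNIV)
    then show ?thesis
      unfolding T0_code_map two_torsion_eq by (simp only: image_image case_prod_unfold tr)
  qed
  have sub: "subgroup (range code_map) B" by (rule subgroup_code_map) simp_all
  show "Gmax \<tau> \<subseteq> range code_map"
    unfolding Gmax_def prod.case by (rule group.generate_subgroup_incl[OF group_BijGroup _ sub]) (auto simp: H)
  show "range code_map \<subseteq> Gmax \<tau>"
  proof
    fix g assume "g \<in> range code_map"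
    then obtain c where "g = code_map c" by (rule rangeE)
    then obtain x y z d where "g = code_map (Code x y z d)" by (cases c) simp
    then have "g = code_map (Code x y z 0 + Code 0 0 0 d)" by simp
    then have "g = code_map (Code x y z 0) \<otimes>\<^bsub>B\<^esub> code_map (Code 0 0 0 d)" unfolding code_map_add .
    moreover have "code_map (Code x y z 0) \<in> ?H" unfolding H by (intro UnI2 range_eqI[of _ _ "(x, y, z)"]) simp
    moreover have "code_map (Code 0 0 0 d) \<in> ?H" unfolding H by blast
    ultimately show "g \<in> Gmax \<tau>"
      unfolding Gmax_def prod.case by (simp only:) (intro generate.eng generate.incl)
  qed
qed

lemma essential_imp_essential_code:
  assumes "essential \<tau> G"
  obtains S where "G = code_map ` S" "essential_code S"
proof
  let ?S = "code_map -` G"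
  have G: "subgroup G B" "G \<subseteq> range code_map" "no_factor_translation \<tau> G"
    using assms by (auto simp: essential_def Gmax_code_map)
  show "G = code_map ` ?S" using G(2) by blast
  show "essential_code ?S"
  proof
    show "0 \<in> ?S" using subgroup.one_closed[OF G(1)] code_map_0 by simp
    show "a + b \<in> ?S" if "a \<in> ?S" "b \<in> ?S" for a b
      using that subgroup.m_closed[OF G(1)] by (simp add: code_map_add)
    fix c i j k assume c: "index_perm i j k" "c \<in> ?S" "twist c = 0" "coord j c = 0" "coord k c = 0"
    have tr: "transl \<tau> (tors_point t1 (coord 0 c), tors_point t2 (coord 1 c), tors_point t3 (coord 2 c)) \<in> G"
      using c(2) code_map_translation[OF c(3)] by (simp add: shift_of_def)
    have "coord i c = 0"
      using G(3) tr c(1,4,5) tors_point_diff_lattice_iff[OF t1, of "coord 0 c" 0] tors_point_diff_lattice_iff[OF t2, of "coord 1 c" 0]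
        tors_point_diff_lattice_iff[OF t3, of "coord 2 c" 0]
      unfolding index_perm_def no_factor_translation_def by auto
    then show "c = 0" using c by (intro code_eqI[OF c(1)]) simp_all
  qed
qed

lemma essential_code_imp_essential:
  assumes S: "essential_code S" and tw: "twist ` S = UNIV"
  shows "essential \<tau> (code_map ` S)"
  unfolding essential_def
proof (intro conjI)
  interpret essential_code S by fact
  show "subgroup (code_map ` S) B" by (rule subgroup_code_map[OF zero add])
  show "code_map ` S \<subseteq> Gmax \<tau>" unfolding Gmax_code_map by blast
  have T0: "mv \<tau> (0, 0, 0) (signs_of c) = code_map (Code 0 0 0 (twist c))" for c
    using signs_of_eq_iff[of c "Code 0 0 0 (twist c)"] by (simp add: code_map_def shift_of_def coord_def)
  show "twist_part \<tau> (code_map ` S) = T0 \<tau>"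
  proof (intro equalityI subsetI)
    fix g assume "g \<in> twist_part \<tau> (code_map ` S)"
    then obtain d e c where d: "g = mv \<tau> (0, 0, 0) d" "d \<in> signs" "mv \<tau> e d = code_map c"
      by (auto simp: twist_part_def)
    have "d = signs_of c" using mv_eqD(1)[OF d(2) signs_of_signs d(3)[unfolded code_map_def]] .
    then show "g \<in> T0 \<tau>" unfolding T0_code_map d(1) using T0 by simp
  next
    fix g assume "g \<in> T0 \<tau>"
    then obtain d where d: "g = code_map (Code 0 0 0 d)" by (auto simp: T0_code_map)
    obtain c where "c \<in> S" "twist c = d" using tw by (metis UNIV_I imageE)
    then have "g = mv \<tau> (0, 0, 0) (signs_of c)" "mv \<tau> (shift_of c) (signs_of c) \<in> code_map ` S"
      using T0[of c] d by (simp_all add: code_map_def)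
    then show "g \<in> twist_part \<tau> (code_map ` S)" unfolding twist_part_def using signs_of_signs by blast
  qed
  show "no_factor_translation \<tau> (code_map ` S)"
  proof -
    \<comment> \<open>The three factors are treated at once: the list indexing says that the entries
      in directions \<open>j\<close> and \<open>k\<close> vanish, which forces the code to be 0 and
      the remaining entry into its lattice.\<close>
    have *: "False" if as: "transl \<tau> (a1, a2, a3) \<in> code_map ` S" "index_perm i j k"
      "\<not> (a1 \<in> lattice t1 \<and> a2 \<in> lattice t2 \<and> a3 \<in> lattice t3)"
      "\<forall>l\<in>{j, k}. [a1, a2, a3] ! l = 0" for a1 a2 a3 i j k
    proof -
      obtain c where c: "c \<in> S" "mv \<tau> (a1, a2, a3) (1, 1, 1) = mv \<tau> (shift_of c) (signs_of c)"
        using as(1) unfolding code_map_def by blast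
      have one: "(1, 1, 1) \<in> signs" by (simp add: signs_def)
      note eq = mv_eqD[OF one signs_of_signs c(2)]
      have tw: "twist c = 0" using eq(1) signs_of_eq_iff[of c 0] by (simp add: signs_of_def unit_of_bit_def)
      have neg: "- tors_point t x \<in> lattice t \<Longrightarrow> Im t \<noteq> 0 \<Longrightarrow> x = 0" for t x
        using tors_point_diff_lattice_iff[of t 0 x] by simp
      have "coord j c = 0" "coord k c = 0"
        using eq(2-4) as(2,4) neg[OF _ t1, of "coord 0 c"] neg[OF _ t2, of "coord 1 c"] neg[OF _ t3, of "coord 2 c"] unfolding index_perm_def by (auto simp: shift_of_def)
      then have "c = 0" using no_factor[OF as(2) c(1) tw] by blast
      then show False using eq(2-4) as(3) by (simp add: shift_of_def)
    qed
    show ?thesis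
      unfolding no_factor_translation_def prod.case
    proof (intro conjI allI impI notI)
      fix a
      show False if "a \<notin> lattice t1" "transl \<tau> (a, 0, 0) \<in> code_map ` S"
        by (rule *[OF that(2), of 0 1 2]) (use that(1) in \<open>simp_all add: index_perm_def\<close>)
      show False if "a \<notin> lattice t2" "transl \<tau> (0, a, 0) \<in> code_map ` S"
        by (rule *[OF that(2), of 1 0 2]) (use that(1) in \<open>simp_all add: index_perm_def\<close>)
      show False if "a \<notin> lattice t3" "transl \<tau> (0, 0, a) \<in> code_map ` S"
        by (rule *[OF that(2), of 2 0 1]) (use that(1) in \<open>simp_all add: index_perm_def\<close>)
    qed
  qed
qed

lemma xor_span_stats:
  assumes "essential_list (xor_span as)" "stats (xor_span as) = (v, s, N)"
  shows "essential_code (set (xor_span as))" "card (transls (set (xor_span as))) = v"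
    "fixer_total (set (xor_span as)) = s" "card (triangles (set (xor_span as))) = N"
    "torsion_sum (set (xor_span as)) \<epsilon> = (\<Sum>(g, h)\<leftarrow>triangles_list (xor_span as). \<epsilon> g h)"
    "essential \<tau> (code_map ` set (xor_span as))"
proof -
  have d: "distinct (xor_span as)" and nf: "no_factor_list (xor_span as)"
    and tw: "twist ` set (xor_span as) = {(0, 0), (0, 1), (1, 0), (1, 1)}"
    using assms(1) by (simp_all add: essential_list_def)
  show ess: "essential_code (set (xor_span as))" by (rule essential_code_xor_span[OF nf])
  show "card (transls (set (xor_span as))) = v" "fixer_total (set (xor_span as)) = s"
    "card (triangles (set (xor_span as))) = N"
    using assms(2) list_stats[OF d] list_triangles(1)[OF d] by (simp_all add: stats_def fixer_total_def)
  show "torsion_sum (set (xor_span as)) \<epsilon> = (\<Sum>(g, h)\<leftarrow>triangles_list (xor_span as). \<epsilon> g h)"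
    by (rule list_triangles(2)[OF d])
  have "twist ` set (xor_span as) = UNIV"
    by (simp only: tw UNIV_two_tors)
  then show "essential \<tau> (code_map ` set (xor_span as))" by (rule essential_code_imp_essential[OF ess])
qed

lemma trivial_pair_xor_span:
  assumes "essential_list (xor_span as) \<and> stats (xor_span as) = (v, s, N)"
  shows "hodge_of v s (int N) \<in> {hodge_pair \<tau> G trivial_torsion | G. essential \<tau> G}"
proof -
  note st = xor_span_stats[OF conjunct1[OF assms] conjunct2[OF assms]]
  have "hodge_of v s (int N) = hodge_pair \<tau> (code_map ` set (xor_span as)) trivial_torsion"
    using hodge_pair_trivial[OF st(1)] st(2-4) by simp
  then show ?thesis using st(6) by blast
qed

lemma hodge_values_two:
  assumes "essential_list (xor_span as) \<and> stats (xor_span as) = (v, s, 2) \<and>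
      (\<Sum>(g, h)\<leftarrow>triangles_list (xor_span as). wedge (sign_bit 1) (\<lambda>c. fst (coord 0 c)) g h) = 0"
  shows "hodge_values \<tau> (code_map ` set (xor_span as)) = {hodge_of v s 2, hodge_of v s 0, hodge_of v s (-2)}"
proof -
  have full: "essential_list (xor_span as)" "stats (xor_span as) = (v, s, 2)" using assms by blast+
  note st = xor_span_stats[OF full]
  have alt: "alternating (set (xor_span as)) (wedge (sign_bit 1) (\<lambda>c. fst (coord 0 c)))"
    by (rule alternating_wedge) simp_all
  have "0 = torsion_sum (set (xor_span as)) (wedge (sign_bit 1) (\<lambda>c. fst (coord 0 c)))"
    using assms unfolding st(5) by simp
  then have "0 \<in> torsion_sums (set (xor_span as))" unfolding torsion_sums_def using alt by blast
  then have "torsion_sums (set (xor_span as)) = {2, 0, -2}" by (rule torsion_sums_two[OF st(1,4)])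
  then show ?thesis unfolding hodge_values_code_map[OF st(1)] st(2,3) by simp
qed

lemma hodge_values_four:
  assumes "essential_list (xor_span as) \<and> stats (xor_span as) = (v, s, 4) \<and>
      (\<Sum>(g, h)\<leftarrow>triangles_list (xor_span as). wedge (sign_bit 1) (\<lambda>c. fst (coord 0 c)) g h) = 0 \<and>
      (\<Sum>(g, h)\<leftarrow>triangles_list (xor_span as). wedge (\<lambda>c. snd (coord 0 c)) (\<lambda>c. fst (coord 1 c)) g h) = 2"
  shows "hodge_values \<tau> (code_map ` set (xor_span as)) =
    {hodge_of v s 4, hodge_of v s 2, hodge_of v s 0, hodge_of v s (-2), hodge_of v s (-4)}"
proof -
  have full: "essential_list (xor_span as)" "stats (xor_span as) = (v, s, 4)" using assms by blast+
  note st = xor_span_stats[OF full]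
  have alt: "alternating (set (xor_span as)) (wedge (sign_bit 1) (\<lambda>c. fst (coord 0 c)))"
    "alternating (set (xor_span as)) (wedge (\<lambda>c. snd (coord 0 c)) (\<lambda>c. fst (coord 1 c)))"
    by (rule alternating_wedge; simp)+
  have "0 = torsion_sum (set (xor_span as)) (wedge (sign_bit 1) (\<lambda>c. fst (coord 0 c)))"
    "2 = torsion_sum (set (xor_span as)) (wedge (\<lambda>c. snd (coord 0 c)) (\<lambda>c. fst (coord 1 c)))"
    using assms unfolding st(5) by simp_all
  then have "0 \<in> torsion_sums (set (xor_span as))" "2 \<in> torsion_sums (set (xor_span as))"
    unfolding torsion_sums_def using alt by blast+
  then have "torsion_sums (set (xor_span as)) = {4, 2, 0, -2, -4}" by (rule torsion_sums_four[OF st(1,4)])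
  then show ?thesis unfolding hodge_values_code_map[OF st(1)] st(2,3) by simp
qed

end

section \<open>Intermediate torsion values, the listed groups and the symmetrization\<close>

text \<open>With at most one triangle only the extreme sums N and -N occur. Otherwise
  \<open>counts\<close> leaves few triples (v, s, N), and \<open>hodge_of\<close> at the
  intermediate sums gives the listed pairs.\<close>

lemma (in essential_code) torsion_values:
  assumes "d \<in> torsion_sums S"
  shows "d = int (card (triangles S)) \<or> d = - int (card (triangles S)) \<or>
    hodge_of (card (transls S)) (fixer_total S) d \<in> {(15, 15), (11, 11), (9, 9), (12, 6), (6, 12)}"
proof -
  obtain n where n: "n \<le> card (triangles S)" "d = int (card (triangles S)) - 2 * int n"
    using torsion_sums_subset[OF assms] by blast
  consider "card (triangles S) \<le> 1"
    | "card (triangles S) = 2" "(card (transls S), fixer_total S) \<in> {(4, 6), (8, 6), (8, 8), (16, 12)}"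
    | "card (triangles S) = 4" "(card (transls S), fixer_total S) = (16, 12)"
    using counts unfolding fixer_total_def by blast
  then show ?thesis
  proof cases
    case 1
    then have "card (triangles S) = 0 \<or> card (triangles S) = 1" "n = 0 \<or> n = 1" using n by linarith+
    then show ?thesis using n by auto
  next
    case 2
    then have "n = 0 \<or> n = 1 \<or> n = 2" using n by linarith
    then have "d = 2 \<or> d = -2 \<or> d = 0" using n 2 by auto
    then show ?thesis using 2 by (auto simp: hodge_of_def)
  next
    case 3
    then have "n = 0 \<or> n = 1 \<or> n = 2 \<or> n = 3 \<or> n = 4" using n by linarith
    then have "d = 4 \<or> d = -4 \<or> d = 0 \<or> d = 2 \<or> d = -2" using n 3 by auto
    then show ?thesis using 3 by (auto simp: hodge_of_def)
  qed
qed

context tori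
begin

lemma hodge_values_27_3: "hodge_values \<tau> (T0_with \<tau> {(0, 1, 1), (1, 0, 1)}) = {(27, 3), (15, 15), (3, 27)}"
proof -
  let ?as = "[Code (0,0) (1,0) (1,0) (0,0), Code (1,0) (0,0) (1,0) (0,0)]"
  have "{(0, 1, 1), (1, 0, 1)} = shift_of ` set ?as"
    by (simp add: shift_of_def coord_def tors_point_def)
  moreover have "\<forall>c\<in>set ?as. twist c = 0" by (simp add: zero_prod_def)
  ultimately have "T0_with \<tau> {(0, 1, 1), (1, 0, 1)} = code_map ` set (xor_span gens_27_3)"
    unfolding gens_27_3_def by (simp only: T0_with_code_map)
  then show ?thesis
    by (simp only: hodge_values_two[OF stats_27_3]) (simp add: hodge_of_def)
qed

lemma hodge_values_17_5:
  "hodge_values \<tau> (T0_with \<tau> {(1, 1, 0), (t1, t2, 0), (1, t2, 1)}) = {(17, 5), (11, 11), (5, 17)}"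
proof -
  let ?as = "[Code (1,0) (1,0) (0,0) (0,0), Code (0,1) (0,1) (0,0) (0,0), Code (1,0) (0,1) (1,0) (0,0)]"
  have "{(1, 1, 0), (t1, t2, 0), (1, t2, 1)} = shift_of ` set ?as"
    by (simp add: shift_of_def coord_def tors_point_def)
  moreover have "\<forall>c\<in>set ?as. twist c = 0" by (simp add: zero_prod_def)
  ultimately have "T0_with \<tau> {(1, 1, 0), (t1, t2, 0), (1, t2, 1)} = code_map ` set (xor_span gens_17_5)"
    unfolding gens_17_5_def by (simp only: T0_with_code_map)
  then show ?thesis
    by (simp only: hodge_values_two[OF stats_17_5]) (simp add: hodge_of_def)
qed

lemma hodge_values_15_3:
  "hodge_values \<tau> (T0_with \<tau> {(0, 1, 1), (1, 0, 1), (t1, t2, t3)}) = {(15, 3), (9, 9), (3, 15)}"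
proof -
  let ?as = "[Code (0,0) (1,0) (1,0) (0,0), Code (1,0) (0,0) (1,0) (0,0), Code (0,1) (0,1) (0,1) (0,0)]"
  have "{(0, 1, 1), (1, 0, 1), (t1, t2, t3)} = shift_of ` set ?as"
    by (simp add: shift_of_def coord_def tors_point_def)
  moreover have "\<forall>c\<in>set ?as. twist c = 0" by (simp add: zero_prod_def)
  ultimately have "T0_with \<tau> {(0, 1, 1), (1, 0, 1), (t1, t2, t3)} = code_map ` set (xor_span gens_15_3)"
    unfolding gens_15_3_def by (simp only: T0_with_code_map)
  then show ?thesis
    by (simp only: hodge_values_two[OF stats_15_3]) (simp add: hodge_of_def)
qed

lemma hodge_values_15_3':
  "hodge_values \<tau> (T0_with \<tau> {(0, t2, 1), (t1, 1, 0), (1, 0, t3), (1, 1, 1)}) =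
    {(15, 3), (12, 6), (9, 9), (6, 12), (3, 15)}"
proof -
  let ?as = "[Code (0,0) (0,1) (1,0) (0,0), Code (0,1) (1,0) (0,0) (0,0),
    Code (1,0) (0,0) (0,1) (0,0), Code (1,0) (1,0) (1,0) (0,0)]"
  have "{(0, t2, 1), (t1, 1, 0), (1, 0, t3), (1, 1, 1)} = shift_of ` set ?as"
    by (simp add: shift_of_def coord_def tors_point_def)
  moreover have "\<forall>c\<in>set ?as. twist c = 0" by (simp add: zero_prod_def)
  ultimately have "T0_with \<tau> {(0, t2, 1), (t1, 1, 0), (1, 0, t3), (1, 1, 1)} = code_map ` set (xor_span gens_15_3')"
    unfolding gens_15_3'_def by (simp only: T0_with_code_map)
  then show ?thesis
    by (simp only: hodge_values_four[OF stats_15_3']) (simp add: hodge_of_def)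
qed

text \<open>Trivial torsion has sum N, the determinant torsion has sum -N, and negating the sum
  swaps the two entries.\<close>

lemma mirror_torsion:
  assumes "essential \<tau> G"
  shows "\<exists>\<epsilon>. discrete_torsion \<tau> G \<epsilon> \<and> hodge_pair \<tau> G \<epsilon> = prod.swap (hodge_pair \<tau> G trivial_torsion)"
proof -
  obtain S where S: "G = code_map ` S" "essential_code S"
    using essential_imp_essential_code[OF assms] .
  have "- int (card (triangles S)) \<in> torsion_sums S"
    by (rule torsion_sums_uminus[OF card_triangles_in_torsion_sums])
  then have "prod.swap (hodge_pair \<tau> G trivial_torsion) \<in> hodge_values \<tau> G"
    unfolding S(1) hodge_values_code_map[OF S(2)] hodge_pair_trivial[OF S(2)] hodge_of_uminus[symmetric] by (rule imageI)
  then obtain \<epsilon> where "discrete_torsion \<tau> G \<epsilon>" "prod.swap (hodge_pair \<tau> G trivial_torsion) = hodge_pair \<tau> G \<epsilon>"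
    unfolding hodge_values_def by blast
  then show ?thesis by metis
qed

text \<open>An extreme torsion sum gives the trivial pair of the same group or its swap. An
  intermediate sum gives one of five pairs, which four explicit groups realize with trivial torsion
  up to the swap. The converse inclusion is mirror torsion.\<close>

lemma hodge_pairs_symmetrization:
  defines "triv \<equiv> {hodge_pair \<tau> G trivial_torsion | G. essential \<tau> G}"
  shows "{hodge_pair \<tau> G \<epsilon> | G \<epsilon>. essential \<tau> G \<and> discrete_torsion \<tau> G \<epsilon>} = triv \<union> prod.swap ` triv"
proof (intro equalityI subsetI)
  fix x assume "x \<in> {hodge_pair \<tau> G \<epsilon> | G \<epsilon>. essential \<tau> G \<and> discrete_torsion \<tau> G \<epsilon>}"
  then obtain G \<epsilon> where G: "essential \<tau> G" "discrete_torsion \<tau> G \<epsilon>" "x = hodge_pair \<tau> G \<epsilon>" by blast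
  obtain S where S: "G = code_map ` S" "essential_code S"
    using essential_imp_essential_code[OF G(1)] .
  have "x \<in> hodge_values \<tau> (code_map ` S)" unfolding hodge_values_def using G S(1) by blast
  then obtain d where d: "d \<in> torsion_sums S" "x = hodge_of (card (transls S)) (fixer_total S) d"
    unfolding hodge_values_code_map[OF S(2)] by blast
  let ?t = "hodge_of (card (transls S)) (fixer_total S) (int (card (triangles S)))"
  have t: "?t \<in> triv"
    unfolding triv_def using G(1) hodge_pair_trivial[OF S(2), symmetric] unfolding S(1) by blast
  have r: "(15, 15) \<in> triv" "(11, 11) \<in> triv" "(9, 9) \<in> triv" "(12, 6) \<in> triv"
    using trivial_pair_xor_span[OF stats_15_15] trivial_pair_xor_span[OF stats_11_11]
      trivial_pair_xor_span[OF stats_9_9] trivial_pair_xor_span[OF stats_12_6]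
    unfolding triv_def by (simp_all add: hodge_of_def)
  have "(6, 12) \<in> prod.swap ` triv" by (rule image_eqI[OF _ r(4)]) simp
  moreover have "prod.swap ?t \<in> prod.swap ` triv" using t by (rule imageI)
  moreover have "x = ?t \<or> x = prod.swap ?t \<or> x \<in> {(15, 15), (11, 11), (9, 9), (12, 6), (6, 12)}"
    using essential_code.torsion_values[OF S(2) d(1)] unfolding d(2) hodge_of_uminus[symmetric] by blast
  ultimately show "x \<in> triv \<union> prod.swap ` triv" using t r by blast
next
  fix x assume "x \<in> triv \<union> prod.swap ` triv"
  then obtain G where G: "essential \<tau> G"
    "x = hodge_pair \<tau> G trivial_torsion \<or> x = prod.swap (hodge_pair \<tau> G trivial_torsion)"
    unfolding triv_def by blast
  have "discrete_torsion \<tau> G trivial_torsion" by (simp add: discrete_torsion_def)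
  then have "\<exists>\<epsilon>. discrete_torsion \<tau> G \<epsilon> \<and> x = hodge_pair \<tau> G \<epsilon>"
    using G(2) mirror_torsion[OF G(1)] by metis
  then show "x \<in> {hodge_pair \<tau> G \<epsilon> | G \<epsilon>. essential \<tau> G \<and> discrete_torsion \<tau> G \<epsilon>}"
    using G(1) by blast
qed

end

theorem mainTheorem7:
  fixes \<tau>1 \<tau>2 \<tau>3 :: complex and \<tau> :: triple
  assumes "Im \<tau>1 \<noteq> 0" and "Im \<tau>2 \<noteq> 0" and "Im \<tau>3 \<noteq> 0"
    and "\<tau> = (\<tau>1, \<tau>2, \<tau>3)"
  shows
    "(\<forall>G. essential \<tau> G \<longrightarrow>
        (\<exists>\<epsilon>. discrete_torsion \<tau> G \<epsilon> \<and>
          hodge_pair \<tau> G \<epsilon> = prod.swap (hodge_pair \<tau> G trivial_torsion))) \<and>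
     hodge_values \<tau> (T0_with \<tau> {(0, 1, 1), (1, 0, 1)}) = {(27, 3), (15, 15), (3, 27)} \<and>
     hodge_values \<tau> (T0_with \<tau> {(1, 1, 0), (\<tau>1, \<tau>2, 0), (1, \<tau>2, 1)}) =
       {(17, 5), (11, 11), (5, 17)} \<and>
     hodge_values \<tau> (T0_with \<tau> {(0, 1, 1), (1, 0, 1), (\<tau>1, \<tau>2, \<tau>3)}) =
       {(15, 3), (9, 9), (3, 15)} \<and>
     hodge_values \<tau> (T0_with \<tau> {(0, \<tau>2, 1), (\<tau>1, 1, 0), (1, 0, \<tau>3), (1, 1, 1)}) =
       {(15, 3), (12, 6), (9, 9), (6, 12), (3, 15)} \<and>
     {hodge_pair \<tau> G \<epsilon> | G \<epsilon>. essential \<tau> G \<and> discrete_torsion \<tau> G \<epsilon>} =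
       {hodge_pair \<tau> G trivial_torsion | G. essential \<tau> G} \<union>
       prod.swap ` {hodge_pair \<tau> G trivial_torsion | G. essential \<tau> G}"
proof -
  interpret tori \<tau>1 \<tau>2 \<tau>3 using assms by unfold_locales
  show ?thesis
    unfolding assms(4)
    using mirror_torsion hodge_values_27_3 hodge_values_17_5 hodge_values_15_3 hodge_values_15_3'
      hodge_pairs_symmetrization
    by blast
qed

end
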